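(* Fix an integer $K\ge1$ and assume the setting in the context, with the H\"older condition holding for some $\alpha\in(\tfrac12,1]$ and $\beta>3-\alpha$. Let $p\ge0$. Then there is a constant $c_1$ depending on $\alpha,\beta,\kappa_\beta,p,\Lambda_0,\Lambda_1$ (and $\kappa_\lambda$) but not on $K$, such that for all $t>0$ and $x\in\mathbb{R}^K$: (a) for all $1\le j\le K$, $$\int_{\mathbb{R}^K}|w'_j|^{2p}Q_K(w',\widetilde A(y,t))\,dw'\le c_1\Big[\int_{\mathbb{R}^j}|w'_j|^{2p}Q_j(w',\widetilde A^j(y,t))\,dw'+1\Big];$$ (b) $\int_{\mathbb{R}^K}Q_K(w',\widetilde A(y,t))\,dw'\le c_1$ and $\int_{\mathbb{R}^K}Q_K(y-x',A(y,t))\,dy\le c_1$.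
   Context: Constants $0<\Lambda_0\le\Lambda_1$, $\kappa_\lambda>0$; $0<\lambda_1\le\dots\le\lambda_K$ with $\kappa_\lambda i^2\le\lambda_i\le\kappa_\lambda^{-1}i^2$. $a:\mathbb{R}^K\to$ symmetric $K\times K$ matrices with $\Lambda_0|v|^2\le\langle a(x)v,v\rangle\le\Lambda_1|v|^2$ for all $x,v$, and (H\"older condition) $|a_{ij}(y+he_k)-a_{ij}(y)|\le\kappa_\beta|h|^\alpha k^{-\beta}$ for all $i,j,k\le K$, $y\in\mathbb{R}^K$, $h\in\mathbb{R}$. For $t>0$: $a_{ij}(y,t)=a_{ij}(y)\int_0^te^{-(\lambda_i+\lambda_j)s}ds$, $A(y,t)=a(y,t)^{-1}$; $g(t)$ is diagonal with $g_{ii}(t)=(1-e^{-2\lambda_it})/(2\lambda_i)$, $G(t)=g(t)^{-1}$; $\widetilde A(y,t)=g(t)^{1/2}A(y,t)g(t)^{1/2}$. For $x\in\mathbb{R}^K$, $x'_i=e^{-\lambda_it}x_i$. For $m\le K$, $\pi_m(y)=(y_1,\dots,y_m,x'_{m+1},\dots,x'_K)$, and $\widetilde A^m(y,t)$ is the inverse of the $m\times m$ matrix with entries $G_{ii}(t)^{1/2}a_{ij}(\pi_m(y),t)G_{jj}(t)^{1/2}$, $i,j\le m$ (so $\widetilde A^K=\widetilde A$). For positive definite $m\times m$ $C$ and $w\in\mathbb{R}^m$, $Q_m(w,C)=(2\pi)^{-m/2}(\det C)^{1/2}e^{-\langle w,Cw\rangle/2}$. In integrals with respect to $w'$ (in $\mathbb{R}^K$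 or $\mathbb{R}^j$), $y$ is the function of $w'$ given by $y_i=x'_i+g_{ii}(t)^{1/2}w'_i$ for the integrated coordinates (i.e. $w'=G(t)^{1/2}(y-x')$), the remaining coordinates being irrelevant via $\pi_j$. *)

theory Defs
  imports "HOL-Analysis.Analysis"
begin

text \<open>Vectors in R^K are functions nat => real, with coordinates indexed by {1..K};
  K x K matrices are functions nat => nat => real on the index set {1..K}.\<close>

definition det_on :: "nat set \<Rightarrow> (nat \<Rightarrow> nat \<Rightarrow> real) \<Rightarrow> real" where
  "det_on I M = (\<Sum>q | q permutes I. of_int (sign q) * (\<Prod>i\<in>I. M i (q i)))"

definition mat_inv_on :: "nat set \<Rightarrow> (nat \<Rightarrow> nat \<Rightarrow> real) \<Rightarrow> (nat \<Rightarrow> nat \<Rightarrow> real)" where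
  "mat_inv_on I M = (SOME B. \<forall>i\<in>I. \<forall>j\<in>I.
      (\<Sum>k\<in>I. M i k * B k j) = (if i = j then 1 else 0))"

definition quad_on :: "nat set \<Rightarrow> (nat \<Rightarrow> nat \<Rightarrow> real) \<Rightarrow> (nat \<Rightarrow> real) \<Rightarrow> real" where
  "quad_on I C w = (\<Sum>i\<in>I. \<Sum>j\<in>I. w i * C i j * w j)"

definition Qd :: "nat set \<Rightarrow> (nat \<Rightarrow> real) \<Rightarrow> (nat \<Rightarrow> nat \<Rightarrow> real) \<Rightarrow> real" where
  "Qd I w C = (2 * pi) powr (- real (card I) / 2) * sqrt (det_on I C) * exp (- quad_on I C w / 2)"

text \<open>|x|^q with the convention 0^0 = 1.\<close>
definition abspow :: "real \<Rightarrow> real \<Rightarrow> real" where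
  "abspow x q = (if q = 0 then 1 else \<bar>x\<bar> powr q)"

definition aT :: "(nat \<Rightarrow> real) \<Rightarrow> ((nat \<Rightarrow> real) \<Rightarrow> nat \<Rightarrow> nat \<Rightarrow> real) \<Rightarrow> (nat \<Rightarrow> real)
    \<Rightarrow> real \<Rightarrow> nat \<Rightarrow> nat \<Rightarrow> real" where
  "aT lam a y t i j = a y i j * integral {0..t} (\<lambda>s. exp (- (lam i + lam j) * s))"

definition AT :: "nat \<Rightarrow> (nat \<Rightarrow> real) \<Rightarrow> ((nat \<Rightarrow> real) \<Rightarrow> nat \<Rightarrow> nat \<Rightarrow> real) \<Rightarrow> (nat \<Rightarrow> real)
    \<Rightarrow> real \<Rightarrow> nat \<Rightarrow> nat \<Rightarrow> real" where
  "AT K lam a y t = mat_inv_on {1..K} (aT lam a y t)"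

definition gd :: "(nat \<Rightarrow> real) \<Rightarrow> real \<Rightarrow> nat \<Rightarrow> real" where
  "gd lam t i = (1 - exp (- 2 * lam i * t)) / (2 * lam i)"

definition Gd :: "(nat \<Rightarrow> real) \<Rightarrow> real \<Rightarrow> nat \<Rightarrow> real" where
  "Gd lam t i = 1 / gd lam t i"

definition AtT :: "nat \<Rightarrow> (nat \<Rightarrow> real) \<Rightarrow> ((nat \<Rightarrow> real) \<Rightarrow> nat \<Rightarrow> nat \<Rightarrow> real) \<Rightarrow> (nat \<Rightarrow> real)
    \<Rightarrow> real \<Rightarrow> nat \<Rightarrow> nat \<Rightarrow> real" where
  "AtT K lam a y t i j = sqrt (gd lam t i) * AT K lam a y t i j * sqrt (gd lam t j)"

definition xp :: "(nat \<Rightarrow> real) \<Rightarrow> real \<Rightarrow> (nat \<Rightarrow> real) \<Rightarrow> nat \<Rightarrow> real" where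
  "xp lam t x i = exp (- lam i * t) * x i"

definition pim :: "nat \<Rightarrow> (nat \<Rightarrow> real) \<Rightarrow> real \<Rightarrow> (nat \<Rightarrow> real) \<Rightarrow> nat \<Rightarrow> (nat \<Rightarrow> real) \<Rightarrow> nat \<Rightarrow> real" where
  "pim K lam t x m y = restrict (\<lambda>i. if i \<le> m then y i else xp lam t x i) {1..K}"

definition Atm :: "nat \<Rightarrow> (nat \<Rightarrow> real) \<Rightarrow> ((nat \<Rightarrow> real) \<Rightarrow> nat \<Rightarrow> nat \<Rightarrow> real) \<Rightarrow> (nat \<Rightarrow> real)
    \<Rightarrow> nat \<Rightarrow> (nat \<Rightarrow> real) \<Rightarrow> real \<Rightarrow> nat \<Rightarrow> nat \<Rightarrow> real" where
  "Atm K lam a x m y t = mat_inv_on {1..m}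
     (\<lambda>i j. sqrt (Gd lam t i) * aT lam a (pim K lam t x m y) t i j * sqrt (Gd lam t j))"

text \<open>y as a function of w' on the integrated coordinates J: y_i = x'_i + g_ii^{1/2} w'_i\<close>
definition yof :: "nat set \<Rightarrow> (nat \<Rightarrow> real) \<Rightarrow> real \<Rightarrow> (nat \<Rightarrow> real) \<Rightarrow> (nat \<Rightarrow> real) \<Rightarrow> nat \<Rightarrow> real" where
  "yof J lam t x w = restrict (\<lambda>i. xp lam t x i + sqrt (gd lam t i) * w i) J"

definition setting :: "real \<Rightarrow> real \<Rightarrow> real \<Rightarrow> real \<Rightarrow> real \<Rightarrow> real \<Rightarrow> nat \<Rightarrow> (nat \<Rightarrow> real)
    \<Rightarrow> ((nat \<Rightarrow> real) \<Rightarrow> nat \<Rightarrow> nat \<Rightarrow> real) \<Rightarrow> bool" where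
  "setting L0 L1 kl \<alpha> \<beta> kb K lam a \<longleftrightarrow>
     0 < lam 1 \<and>
     (\<forall>i. 1 \<le> i \<and> i < K \<longrightarrow> lam i \<le> lam (Suc i)) \<and>
     (\<forall>i\<in>{1..K}. kl * real i ^ 2 \<le> lam i \<and> lam i \<le> real i ^ 2 / kl) \<and>
     (\<forall>y\<in>PiE {1..K} (\<lambda>_. UNIV). \<forall>i\<in>{1..K}. \<forall>j\<in>{1..K}. a y i j = a y j i) \<and>
     (\<forall>y\<in>PiE {1..K} (\<lambda>_. UNIV). \<forall>v::nat \<Rightarrow> real.
        L0 * (\<Sum>i\<in>{1..K}. v i ^ 2) \<le> (\<Sum>i\<in>{1..K}. \<Sum>j\<in>{1..K}. a y i j * v i * v j) \<and>
        (\<Sum>i\<in>{1..K}. \<Sum>j\<in>{1..K}. a y i j * v i * v j) \<le> L1 * (\<Sum>i\<in>{1..K}. v i ^ 2)) \<and>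
     (\<forall>y\<in>PiE {1..K} (\<lambda>_. UNIV). \<forall>i\<in>{1..K}. \<forall>j\<in>{1..K}. \<forall>k\<in>{1..K}. \<forall>h::real.
        \<bar>a (y(k := y k + h)) i j - a y i j\<bar> \<le> kb * \<bar>h\<bar> powr \<alpha> * real k powr (- \<beta>))"

end

theory Submission
  imports Defs "HOL-Probability.Probability" "Jordan_Normal_Form.Determinant"
begin

text \<open>
  The dimension is lowered dyadically. Let \<open>b\<^sub>m(w)\<close> be the rescaled covariance with the coordinates
  beyond \<open>m\<close> frozen at \<open>x'\<close>, and let \<open>m < n \<le> 2 m\<close>. By Hoelder continuity and \<open>g\<^sub>k \<le> C k\<^sup>-\<^sup>2\<close>, the entries of
  \<open>b\<^sub>n - b\<^sub>m\<close> are at most \<open>C m\<^sup>-\<^sup>\<alpha>\<^sup>-\<^sup>\<beta> \<Sum>\<^sub>k |w\<^sub>k|\<^sup>\<alpha>\<close> with \<open>k\<close> ranging over \<open>(m, n]\<close>. On \<open>|w|\<^sup>2 \<le> R n\<close> this is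
  \<open>O(m\<^sup>1\<^sup>-\<^sup>\<alpha>\<^sup>-\<^sup>\<beta>)\<close>, so the operator norm of the difference is \<open>O(m\<^sup>2\<^sup>-\<^sup>\<alpha>\<^sup>-\<^sup>\<beta>)\<close> and the logarithms of the two Gaussian
  densities differ by \<open>O(m\<^sup>3\<^sup>-\<^sup>\<alpha>\<^sup>-\<^sup>\<beta>)\<close>, pointwise. The density with covariance \<open>b\<^sub>m\<close> can be integrated exactly
  over the coordinates beyond \<open>m\<close>, on which \<open>b\<^sub>m\<close> does not depend, and the set \<open>|w|\<^sup>2 > R n\<close> contributes at
  most \<open>C exp (- n)\<close> for large \<open>R\<close>. Along \<open>n = j, 2 j, 4 j, \<dots>\<close> the errors form a geometric series because
  \<open>\<alpha> + \<beta> > 3\<close>. Changing a whole dyadic block at once is what makes the estimate work: only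
  \<open>\<Sum>\<^sub>k |w\<^sub>k|\<^sup>\<alpha>\<close> over the block has to be controlled, never a single \<open>w\<^sub>m\<close>.
\<close>

subsection \<open>Inverses of positive definite matrices\<close>

text \<open>The bounds \<open>l\<close> and \<open>u\<close> on the spectrum are carried explicitly,
  since later constants may depend on them but not on the dimension.\<close>

definition pd :: "nat set \<Rightarrow> real \<Rightarrow> real \<Rightarrow> (nat \<Rightarrow> nat \<Rightarrow> real) \<Rightarrow> bool" where
  "pd I l u M \<longleftrightarrow> (\<forall>i\<in>I. \<forall>j\<in>I. M i j = M j i) \<and>
     (\<forall>v. l * (\<Sum>i\<in>I. (v i)\<^sup>2) \<le> quad_on I M v \<and> quad_on I M v \<le> u * (\<Sum>i\<in>I. (v i)\<^sup>2))"

text \<open>The property by which \<open>mat_inv_on\<close> makes its choice. Entries off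
  \<open>I\<close> are unconstrained, so identities between inverses are stated entrywise on
  \<open>I\<close>.\<close>

definition is_inv :: "nat set \<Rightarrow> (nat \<Rightarrow> nat \<Rightarrow> real) \<Rightarrow> (nat \<Rightarrow> nat \<Rightarrow> real) \<Rightarrow> bool" where
  "is_inv I M C \<longleftrightarrow> (\<forall>i\<in>I. \<forall>j\<in>I. (\<Sum>k\<in>I. M i k * C k j) = (if i = j then 1 else 0))"

definition to_mat :: "nat \<Rightarrow> (nat \<Rightarrow> nat \<Rightarrow> real) \<Rightarrow> real mat" where
  "to_mat n M = Matrix.mat n n (\<lambda>(i, j). M (Suc i) (Suc j))"

lemma to_mat_carrier [simp]: "to_mat n M \<in> carrier_mat n n"
  by (simp add: to_mat_def)

lemma to_mat_index [simp]: "i < n \<Longrightarrow> j < n \<Longrightarrow> to_mat n M $$ (i, j) = M (Suc i) (Suc j)"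
  by (simp add: to_mat_def)

text \<open>Extending a test vector by zero turns the form on \<open>J\<close> into the form on
  \<open>I\<close>.\<close>

lemma pd_subset:
  assumes "pd I l u M" "J \<subseteq> I" "finite I"
  shows "pd J l u M"
proof -
  have fin: "finite J" using assms finite_subset by blast
  { fix v :: "nat \<Rightarrow> real"
    let ?v = "\<lambda>i. if i \<in> J then v i else 0"
    have 1: "(\<Sum>i\<in>I. (?v i)\<^sup>2) = (\<Sum>i\<in>J. (v i)\<^sup>2)"
      by (rule sum.mono_neutral_cong_right) (use assms in auto)
    have 2: "quad_on I M ?v = quad_on J M v"
      unfolding quad_on_def
    proof (rule sum.mono_neutral_cong_right)
      fix i assume "i \<in> J"
      then show "(\<Sum>j\<in>I. ?v i * M i j * ?v j) = (\<Sum>j\<in>J. v i * M i j * v j)"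
        by (intro sum.mono_neutral_cong_right) (use assms in auto)
    qed (use assms in auto)
    have "l * (\<Sum>i\<in>I. (?v i)\<^sup>2) \<le> quad_on I M ?v \<and> quad_on I M ?v \<le> u * (\<Sum>i\<in>I. (?v i)\<^sup>2)"
      using assms(1)[unfolded pd_def, THEN conjunct2, THEN spec, of ?v] .
    then have "l * (\<Sum>i\<in>J. (v i)\<^sup>2) \<le> quad_on J M v \<and> quad_on J M v \<le> u * (\<Sum>i\<in>J. (v i)\<^sup>2)"
      unfolding 1 2 . }
  then show ?thesis using assms unfolding pd_def by blast
qed

lemma quad_on_alt: "quad_on I M v = (\<Sum>i\<in>I. v i * (\<Sum>j\<in>I. M i j * v j))"
  by (simp add: quad_on_def sum_distrib_left mult.assoc)

lemma pd_kernel: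
  assumes "pd I l u M" "l > 0" "finite I" "\<And>i. i \<in> I \<Longrightarrow> (\<Sum>j\<in>I. M i j * v j) = 0" "i \<in> I"
  shows "v i = 0"
proof -
  have "quad_on I M v = 0" unfolding quad_on_alt using assms by simp
  moreover have "l * (\<Sum>i\<in>I. (v i)\<^sup>2) \<le> quad_on I M v" using assms(1) unfolding pd_def by blast
  ultimately have "(\<Sum>i\<in>I. (v i)\<^sup>2) \<le> 0" using assms(2) by (simp add: mult_le_0_iff)
  then have "(\<Sum>i\<in>I. (v i)\<^sup>2) = 0" by (simp add: antisym sum_nonneg)
  then show ?thesis using assms by (simp add: sum_nonneg_eq_0_iff)
qed

lemma is_inv_unique:
  assumes "pd I l u M" "l > 0" "finite I" "is_inv I M C" "is_inv I M D" "i \<in> I" "j \<in> I"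
  shows "C i j = D i j"
proof -
  have "C i j - D i j = 0"
  proof (rule pd_kernel[OF assms(1-3) _ assms(6)])
    fix k assume "k \<in> I"
    then show "(\<Sum>i\<in>I. M k i * (C i j - D i j)) = 0"
      using assms by (simp add: right_diff_distrib sum_subtractf is_inv_def)
  qed
  then show ?thesis by simp
qed

text \<open>The product C^T M C equals C^T because M C = 1, and equals C because M is
  symmetric.\<close>

lemma is_inv_sym:
  assumes "pd I l u M" "finite I" "is_inv I M C" "i \<in> I" "j \<in> I"
  shows "C i j = C j i"
proof -
  have "C j i = (\<Sum>k\<in>I. C k i * (\<Sum>m\<in>I. M k m * C m j))"
    using assms by (simp add: is_inv_def if_distrib[of "\<lambda>x. _ * x"] cong: if_cong)
  also have "\<dots> = (\<Sum>m\<in>I. \<Sum>k\<in>I. C k i * (M k m * C m j))"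
    unfolding sum_distrib_left by (rule sum.swap)
  also have "\<dots> = (\<Sum>m\<in>I. (\<Sum>k\<in>I. M m k * C k i) * C m j)"
    unfolding sum_distrib_right
    by (intro sum.cong refl) (use assms(1) in \<open>auto simp: pd_def mult_ac\<close>)
  also have "\<dots> = (\<Sum>m\<in>I. (if m = i then C m j else 0))"
    by (intro sum.cong refl) (use assms in \<open>auto simp: is_inv_def\<close>)
  also have "\<dots> = C i j" using assms by simp
  finally show ?thesis ..
qed

section \<open>Determinants, adjugates and existence of inverses\<close>

lemma sum_shift: "(\<Sum>k\<in>{1..n::nat}. f k) = (\<Sum>k<n. f (Suc k))"
proof -
  have "{1..n} = Suc ` {..<n}" by (simp add: image_Suc_lessThan)
  then show ?thesis by (simp add: sum.reindex)
qed

text \<open>Transport along \<open>Suc\<close> carries the permutations of \<open>{0..<n}\<close> to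
  those of \<open>{1..n}\<close> and keeps signs, so the Leibniz sums agree term by term.\<close>

lemma det_on_to_mat: "det_on {1..n} M = Determinant.det (to_mat n M)"
proof -
  let ?A = "{0..<n}"
  have img: "Suc ` ?A = {1..n}" by auto
  let ?F = "map_permutation ?A Suc"
  have bij: "bij_betw ?F {p. p permutes ?A} {p. p permutes {1..n}}"
  proof -
    have b: "bij_betw Suc ?A {1..n}" using img by (simp add: bij_betw_def)
    have "?F \<pi> = (\<lambda>x. if x \<in> {1..n} then Suc (\<pi> (inv_into ?A Suc x)) else x)" for \<pi>
      unfolding map_permutation_def restrict_id_def img by (auto simp: fun_eq_iff)
    then show ?thesis using bij_betw_permutations[OF b] by (metis (no_types, lifting) bij_betw_cong)
  qed
  have "det_on {1..n} M = (\<Sum>p | p permutes ?A. of_int (sign (?F p)) * (\<Prod>i\<in>{1..n}. M i (?F p i)))"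
    unfolding det_on_def using sum.reindex_bij_betw[OF bij, symmetric] by simp
  also have "\<dots> = (\<Sum>p | p permutes ?A. of_int (sign p) * (\<Prod>i = 0..<n. to_mat n M $$ (i, p i)))"
  proof (intro sum.cong refl)
    fix p assume "p \<in> {p. p permutes ?A}"
    then have p: "p permutes ?A" by simp
    have "(\<Prod>i\<in>{1..n}. M i (?F p i)) = (\<Prod>i\<in>?A. M (Suc i) (?F p (Suc i)))"
      unfolding img[symmetric] by (subst prod.reindex) (auto simp: o_def)
    also have "\<dots> = (\<Prod>i = 0..<n. to_mat n M $$ (i, p i))"
    proof (intro prod.cong refl)
      fix i assume i: "i \<in> ?A"
      then have "p i < n" using permutes_in_image[OF p, of i] by simp
      moreover have "inv_into ?A Suc (Suc i) = i" using i by (intro inv_into_f_f) auto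
      then have "?F p (Suc i) = Suc (p i)"
        using i unfolding map_permutation_def restrict_id_def img by auto
      ultimately show "M (Suc i) (?F p (Suc i)) = to_mat n M $$ (i, p i)" using i by simp
    qed
    finally show "of_int (sign (?F p)) * (\<Prod>i\<in>{1..n}. M i (?F p i)) =
        of_int (sign p) * (\<Prod>i = 0..<n. to_mat n M $$ (i, p i))"
      using sign_map_permutation[OF _ p, of Suc] by simp
  qed
  also have "\<dots> = Determinant.det (to_mat n M)"
    by (rule det_def'[OF to_mat_carrier, symmetric])
  finally show ?thesis .
qed

lemma pd_det_nonzero:
  assumes "pd {1..n} l u M" "l > 0"
  shows "Determinant.det (to_mat n M) \<noteq> 0"
proof
  assume "Determinant.det (to_mat n M) = 0"
  then obtain v where v: "v \<in> carrier_vec n" "v \<noteq> 0\<^sub>v n" "to_mat n M *\<^sub>v v = 0\<^sub>v n"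
    using det_0_iff_vec_prod_zero[OF to_mat_carrier] by blast
  let ?v = "\<lambda>i. vec_index v (i - 1)"
  have "(\<Sum>j\<in>{1..n}. M i j * ?v j) = 0" if "i \<in> {1..n}" for i
  proof -
    have "vec_index (to_mat n M *\<^sub>v v) (i - 1) = 0" using that unfolding v(3) by auto
    moreover have "vec_index (to_mat n M *\<^sub>v v) (i - 1) = (\<Sum>k<n. M i (Suc k) * vec_index v k)"
      using that v(1) by (auto simp: mult_mat_vec_def scalar_prod_def lessThan_atLeast0
          to_mat_def intro!: sum.cong)
    ultimately show ?thesis unfolding sum_shift by simp
  qed
  then have z: "?v i = 0" if "i \<in> {1..n}" for i
    using pd_kernel[OF assms, of ?v i] that by simp
  have "v = 0\<^sub>v n"
  proof
    fix i assume "i < dim_vec (0\<^sub>v n)"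
    then show "vec_index v i = vec_index (0\<^sub>v n) i" using z[of "Suc i"] by simp
  qed (use v in simp)
  then show False using v by simp
qed

text \<open>The explicit formula behind the choice in \<open>mat_inv_on\<close>; it yields existence
  of the inverse, its corner entry and its measurability.\<close>

lemma is_inv_adj:
  assumes "Determinant.det (to_mat n M) \<noteq> 0"
  shows "is_inv {1..n} M (\<lambda>i j. adj_mat (to_mat n M) $$ (i - 1, j - 1) / Determinant.det (to_mat n M))"
  unfolding is_inv_def
proof (intro ballI)
  fix i j assume ij: "i \<in> {1..n}" "j \<in> {1..n}"
  let ?T = "to_mat n M"
  let ?d = "Determinant.det ?T"
  have c: "adj_mat ?T \<in> carrier_mat n n" by (rule adj_mat[OF to_mat_carrier])
  have "(?T * adj_mat ?T) $$ (i - 1, j - 1) = (?d \<cdot>\<^sub>m 1\<^sub>m n) $$ (i - 1, j - 1)"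
    using adj_mat(2)[OF to_mat_carrier[of n M]] by simp
  moreover have "(?T * adj_mat ?T) $$ (i - 1, j - 1) =
      (\<Sum>k<n. M i (Suc k) * adj_mat ?T $$ (k, j - 1))"
    using ij c by (auto simp: scalar_prod_def to_mat_def lessThan_atLeast0 intro!: sum.cong)
  moreover have "(?d \<cdot>\<^sub>m 1\<^sub>m n) $$ (i - 1, j - 1) = ?d * (if i = j then 1 else 0)"
    using ij by auto
  ultimately have "(\<Sum>k<n. M i (Suc k) * adj_mat ?T $$ (k, j - 1)) = ?d * (if i = j then 1 else 0)"
    by simp
  then have "(\<Sum>k<n. M i (Suc k) * adj_mat ?T $$ (k, j - 1)) / ?d = (if i = j then 1 else 0)"
    using assms by simp
  then show "(\<Sum>k\<in>{1..n}. M i k * (adj_mat ?T $$ (k - 1, j - 1) / ?d)) = (if i = j then 1 else 0)"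
    unfolding sum_shift by (simp add: sum_divide_distrib)
qed

lemma is_inv_mat_inv_on:
  assumes "pd {1..n} l u M" "l > 0"
  shows "is_inv {1..n} M (mat_inv_on {1..n} M)"
proof -
  have "\<exists>C. is_inv {1..n} M C" using is_inv_adj[OF pd_det_nonzero[OF assms]] by blast
  then show ?thesis unfolding is_inv_def mat_inv_on_def by (rule someI_ex)
qed

lemma mat_inv_on_eq:
  assumes "pd {1..n} l u M" "l > 0" "is_inv {1..n} M C" "i \<in> {1..n}" "j \<in> {1..n}"
  shows "mat_inv_on {1..n} M i j = C i j"
  using is_inv_unique[OF assms(1,2) _ is_inv_mat_inv_on[OF assms(1,2)] assms(3-5)] by simp

lemma det_inv:
  assumes "is_inv {1..n} M C"
  shows "det_on {1..n} M * det_on {1..n} C = 1"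
proof -
  have "to_mat n M * to_mat n C = 1\<^sub>m n"
  proof (rule eq_matI)
    fix i j assume "i < dim_row (1\<^sub>m n :: real mat)" "j < dim_col (1\<^sub>m n :: real mat)"
    then have ij: "i < n" "j < n" by auto
    have "(to_mat n M * to_mat n C) $$ (i, j) = (\<Sum>k<n. M (Suc i) (Suc k) * C (Suc k) (Suc j))"
      using ij by (auto simp: scalar_prod_def to_mat_def lessThan_atLeast0 intro!: sum.cong)
    also have "\<dots> = (\<Sum>k\<in>{1..n}. M (Suc i) k * C k (Suc j))" unfolding sum_shift by simp
    also have "\<dots> = (if i = j then 1 else 0)" using assms ij unfolding is_inv_def by auto
    finally show "(to_mat n M * to_mat n C) $$ (i, j) = 1\<^sub>m n $$ (i, j)" using ij by auto
  qed (auto simp: to_mat_def)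
  then have "Determinant.det (to_mat n M) * Determinant.det (to_mat n C) = 1"
    using det_mult[OF to_mat_carrier[of n M] to_mat_carrier[of n C]] by simp
  then show ?thesis unfolding det_on_to_mat .
qed

text \<open>Cramer's rule: deleting the last row and column leaves the leading block, and the sign
  of this cofactor is positive.\<close>

lemma inv_corner:
  assumes "pd {1..Suc n} l u M" "l > 0"
  shows "mat_inv_on {1..Suc n} M (Suc n) (Suc n) = det_on {1..n} M / det_on {1..Suc n} M"
proof -
  have "mat_delete (to_mat (Suc n) M) n n = to_mat n M"
    by (rule eq_matI) (auto simp: mat_delete_def to_mat_def)
  then have "cofactor (to_mat (Suc n) M) n n = Determinant.det (to_mat n M)"
    by (simp add: cofactor_def)
  then have "adj_mat (to_mat (Suc n) M) $$ (n, n) = det_on {1..n} M"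
    unfolding det_on_to_mat by (simp add: adj_mat_def to_mat_def)
  then show ?thesis
    using mat_inv_on_eq[OF assms is_inv_adj[OF pd_det_nonzero[OF assms]], of "Suc n" "Suc n"]
    unfolding det_on_to_mat by simp
qed

text \<open>Expand the nonnegative form of \<open>M\<close> at \<open>v - C w\<close>. Equality
  holds at \<open>v = C w\<close>, so the form of the inverse is a maximum over \<open>v\<close>;
  this allows inverses to be compared without diagonalisation.\<close>

lemma quad_inv_variational:
  assumes "pd I l u M" "l \<ge> 0" "finite I" "is_inv I M C"
  shows "2 * (\<Sum>i\<in>I. v i * w i) - quad_on I M v \<le> quad_on I C w"
proof -
  define z where "z i = (\<Sum>j\<in>I. C i j * w j)" for i
  have Mz: "(\<Sum>j\<in>I. M i j * z j) = w i" if "i \<in> I" for i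
  proof -
    have "(\<Sum>j\<in>I. M i j * z j) = (\<Sum>k\<in>I. \<Sum>j\<in>I. M i j * (C j k * w k))"
      unfolding z_def sum_distrib_left by (rule sum.swap)
    also have "\<dots> = (\<Sum>k\<in>I. (\<Sum>j\<in>I. M i j * C j k) * w k)"
      by (simp add: sum_distrib_right mult.assoc)
    also have "\<dots> = (\<Sum>k\<in>I. (if k = i then w k else 0))"
      by (intro sum.cong refl) (use assms(4) that in \<open>auto simp: is_inv_def\<close>)
    also have "\<dots> = w i" using that assms by simp
    finally show ?thesis .
  qed
  have sym: "M i j = M j i" if "i \<in> I" "j \<in> I" for i j using assms(1) that unfolding pd_def by blast
  have "0 \<le> quad_on I M (\<lambda>i. v i - z i)"
    using assms(1) assms(2) unfolding pd_def
    by (meson mult_nonneg_nonneg order_trans sum_nonneg zero_le_power2)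
  also have "\<dots> = (\<Sum>i\<in>I. (v i - z i) * ((\<Sum>j\<in>I. M i j * v j) - w i))"
    unfolding quad_on_alt using Mz by (intro sum.cong refl) (simp add: right_diff_distrib sum_subtractf)
  also have "\<dots> = quad_on I M v - (\<Sum>i\<in>I. v i * w i) - (\<Sum>i\<in>I. z i * (\<Sum>j\<in>I. M i j * v j))
      + (\<Sum>i\<in>I. z i * w i)"
    unfolding quad_on_alt by (simp add: algebra_simps sum.distrib sum_subtractf)
  also have "(\<Sum>i\<in>I. z i * (\<Sum>j\<in>I. M i j * v j)) = (\<Sum>j\<in>I. \<Sum>i\<in>I. z i * (M i j * v j))"
    unfolding sum_distrib_left by (rule sum.swap)
  also have "\<dots> = (\<Sum>j\<in>I. v j * (\<Sum>i\<in>I. M j i * z i))"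
    unfolding sum_distrib_left by (intro sum.cong refl) (use sym in \<open>auto simp: mult_ac\<close>)
  also have "\<dots> = (\<Sum>j\<in>I. v j * w j)" using Mz by simp
  also have "(\<Sum>i\<in>I. z i * w i) = quad_on I C w"
    unfolding quad_on_alt z_def by (simp add: mult.commute)
  finally show ?thesis by simp
qed

lemma quad_inv_at:
  assumes "finite I" "is_inv I M C"
  shows "quad_on I M (\<lambda>i. r * (\<Sum>j\<in>I. C i j * w j)) = r\<^sup>2 * quad_on I C w"
proof -
  have Mz: "(\<Sum>j\<in>I. M i j * (r * (\<Sum>k\<in>I. C j k * w k))) = r * w i" if "i \<in> I" for i
  proof -
    have "(\<Sum>j\<in>I. M i j * (r * (\<Sum>k\<in>I. C j k * w k))) = (\<Sum>k\<in>I. \<Sum>j\<in>I. M i j * (r * (C j k * w k)))"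
      unfolding sum_distrib_left by (rule sum.swap)
    also have "\<dots> = (\<Sum>k\<in>I. (\<Sum>j\<in>I. M i j * C j k) * (r * w k))"
      unfolding sum_distrib_right by (simp add: mult_ac)
    also have "\<dots> = (\<Sum>k\<in>I. (if k = i then r * w k else 0))"
      by (intro sum.cong refl) (use assms that in \<open>auto simp: is_inv_def\<close>)
    also have "\<dots> = r * w i" using that assms by simp
    finally show ?thesis .
  qed
  show ?thesis unfolding quad_on_alt using Mz
    by (simp add: sum_distrib_left power2_eq_square mult_ac)
qed

text \<open>Inversion reverses the Loewner order. The variational bound for \<open>M1\<close> is
  tested at \<open>C2 w / k\<close>, the maximiser of the corresponding expression for
  \<open>k * M2\<close>.\<close>

lemma quad_inv_antimono:
  assumes "pd I l u M1" "l \<ge> 0" "finite I" "is_inv I M1 C1" "is_inv I M2 C2" "k > 0"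
    and "\<And>v. quad_on I M1 v \<le> k * quad_on I M2 v"
  shows "quad_on I C2 w \<le> k * quad_on I C1 w"
proof -
  let ?v = "\<lambda>i. (1/k) * (\<Sum>j\<in>I. C2 i j * w j)"
  have 1: "(\<Sum>i\<in>I. ?v i * w i) = quad_on I C2 w / k"
    unfolding quad_on_alt sum_divide_distrib
    by (intro sum.cong refl) (simp add: sum_divide_distrib[symmetric] mult.commute)
  have 2: "quad_on I M2 ?v = (1/k)\<^sup>2 * quad_on I C2 w"
    by (rule quad_inv_at[OF assms(3,5)])
  have 3: "2 * (\<Sum>i\<in>I. ?v i * w i) - quad_on I M1 ?v \<le> quad_on I C1 w"
    by (rule quad_inv_variational[OF assms(1-4)])
  have 4: "quad_on I M1 ?v \<le> k * quad_on I M2 ?v" by (rule assms)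
  have "2 * (quad_on I C2 w / k) - k * ((1/k)\<^sup>2 * quad_on I C2 w) \<le> quad_on I C1 w"
    using 3 4 unfolding 1 2 by linarith
  then show ?thesis using assms(6) by (simp add: power2_eq_square field_simps)
qed

text \<open>Two comparisons with the identity \<open>E\<close>, with factors \<open>1 / l\<close>
  and \<open>u\<close>.\<close>

lemma quad_inv_bounds:
  assumes "pd I l u M" "l > 0" "u > 0" "finite I" "is_inv I M C"
  shows "quad_on I C w \<le> (\<Sum>i\<in>I. (w i)\<^sup>2) / l" "(\<Sum>i\<in>I. (w i)\<^sup>2) / u \<le> quad_on I C w"
proof -
  define E :: "nat \<Rightarrow> nat \<Rightarrow> real" where "E = (\<lambda>i j. if i = j then 1 else 0)"
  have qE: "quad_on I E v = (\<Sum>i\<in>I. (v i)\<^sup>2)" for v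
    unfolding quad_on_alt E_def using assms(4)
    by (simp add: if_distribR power2_eq_square if_distrib[of "\<lambda>x. x * _"] sum.If_cases cong: if_cong)
  have iE: "is_inv I E E" unfolding is_inv_def E_def using assms(4) by (simp add: if_distrib[of "\<lambda>x. x * _"] cong: if_cong)
  have pE: "pd I 1 1 E" unfolding pd_def qE by (auto simp: E_def)
  have b: "l * (\<Sum>i\<in>I. (v i)\<^sup>2) \<le> quad_on I M v" "quad_on I M v \<le> u * (\<Sum>i\<in>I. (v i)\<^sup>2)" for v
    using assms(1) unfolding pd_def by auto
  have "quad_on I C w \<le> (1/l) * quad_on I E w"
    by (rule quad_inv_antimono[OF pE _ assms(4) iE assms(5)])
       (use assms b qE in \<open>auto simp: field_simps\<close>)
  then show "quad_on I C w \<le> (\<Sum>i\<in>I. (w i)\<^sup>2) / l" by (simp add: qE)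
  have "quad_on I E w \<le> u * quad_on I C w"
    by (rule quad_inv_antimono[OF assms(1) _ assms(4,5) iE]) (use assms b qE in auto)
  then show "(\<Sum>i\<in>I. (w i)\<^sup>2) / u \<le> quad_on I C w" using assms by (simp add: qE field_simps)
qed

lemma inv_diag_pos:
  assumes "pd I l u M" "l > 0" "u > 0" "finite I" "is_inv I M C" "i \<in> I"
  shows "C i i > 0"
proof -
  let ?e = "\<lambda>k. if k = i then 1 else 0 :: real"
  have "quad_on I C ?e = C i i"
    unfolding quad_on_alt using assms by (simp add: if_distrib[of "\<lambda>x. x * _"] if_distrib[of "\<lambda>x. _ * x"] cong: if_cong)
  moreover have "(\<Sum>k\<in>I. (?e k)\<^sup>2) = 1" using assms by (simp add: power2_eq_square if_distrib[of "\<lambda>x. x * _"] cong: if_cong)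
  ultimately show ?thesis using quad_inv_bounds(2)[OF assms(1-5), of ?e] assms(3)
    by (smt (verit) divide_pos_pos)
qed

text \<open>Eliminating the last row of \<open>C\<close> from the identity M C = 1 leaves the Schur
  complement as inverse of the leading block.\<close>

lemma is_inv_minor:
  assumes "pd {1..Suc n} l u M" "is_inv {1..Suc n} M C" "C (Suc n) (Suc n) \<noteq> 0"
  shows "is_inv {1..n} M (\<lambda>i j. C i j - C i (Suc n) * C (Suc n) j / C (Suc n) (Suc n))"
  unfolding is_inv_def
proof (intro ballI)
  fix i j assume ij: "i \<in> {1..n}" "j \<in> {1..n}"
  let ?N = "Suc n"
  have "(\<Sum>k\<in>{1..?N}. M i k * C k j) = (if i = j then 1 else 0)"
    using assms(2) ij unfolding is_inv_def by auto
  then have 1: "(\<Sum>k\<in>{1..n}. M i k * C k j) = (if i = j then 1 else 0) - M i ?N * C ?N j" by simp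
  have "(\<Sum>k\<in>{1..?N}. M i k * C k ?N) = 0"
    using assms(2) ij unfolding is_inv_def by auto
  then have 2: "(\<Sum>k\<in>{1..n}. M i k * C k ?N) = - M i ?N * C ?N ?N" by simp
  have "(\<Sum>k\<in>{1..n}. M i k * (C k j - C k ?N * C ?N j / C ?N ?N)) =
      (\<Sum>k\<in>{1..n}. M i k * C k j) - (\<Sum>k\<in>{1..n}. M i k * C k ?N) * (C ?N j / C ?N ?N)"
    unfolding sum_distrib_right right_diff_distrib sum_subtractf by (simp add: mult.assoc)
  also have "\<dots> = (if i = j then 1 else 0)" unfolding 1 2 using assms(3) by simp
  finally show "(\<Sum>k\<in>{1..n}. M i k * (C k j - C k ?N * C ?N j / C ?N ?N)) = (if i = j then 1 else 0)" .
qed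

lemma quad_on_Suc:
  assumes "\<And>i. i \<in> {1..n} \<Longrightarrow> C i (Suc n) = C (Suc n) i"
  shows "quad_on {1..Suc n} C w = quad_on {1..n} C w
     + 2 * w (Suc n) * (\<Sum>i\<in>{1..n}. C (Suc n) i * w i) + C (Suc n) (Suc n) * (w (Suc n))\<^sup>2"
proof -
  have "(\<Sum>i\<in>{1..n}. w i * C i (Suc n) * w (Suc n)) = w (Suc n) * (\<Sum>i\<in>{1..n}. C (Suc n) i * w i)"
    unfolding sum_distrib_left by (intro sum.cong refl) (use assms in auto)
  moreover have "(\<Sum>i\<in>{1..n}. w (Suc n) * C (Suc n) i * w i) = w (Suc n) * (\<Sum>i\<in>{1..n}. C (Suc n) i * w i)"
    by (simp add: sum_distrib_left mult_ac)
  ultimately show ?thesis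
    unfolding quad_on_def by (simp add: sum.distrib power2_eq_square mult_ac)
qed

lemma quad_on_cong:
  "(\<And>i j. i \<in> I \<Longrightarrow> j \<in> I \<Longrightarrow> C i j = D i j) \<Longrightarrow> (\<And>i. i \<in> I \<Longrightarrow> v i = w i) \<Longrightarrow>
    quad_on I C v = quad_on I D w"
  unfolding quad_on_def by (intro sum.cong refl) auto

lemma det_on_cong:
  assumes "\<And>i j. i \<in> I \<Longrightarrow> j \<in> I \<Longrightarrow> C i j = D i j"
  shows "det_on I C = det_on I D"
  unfolding det_on_def
proof (intro sum.cong refl arg_cong2[where f="(*)"] prod.cong)
  fix q i assume "q \<in> {q. q permutes I}" "i \<in> I"
  then show "C i (q i) = D i (q i)" using assms permutes_in_image[of q I i] by auto
qed

lemma Qd_cong: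
  "(\<And>i j. i \<in> I \<Longrightarrow> j \<in> I \<Longrightarrow> C i j = D i j) \<Longrightarrow> (\<And>i. i \<in> I \<Longrightarrow> v i = w i) \<Longrightarrow> Qd I v C = Qd I w D"
  unfolding Qd_def using quad_on_cong[of I C D v w] det_on_cong[of I C D] by simp

text \<open>Completing the square in the last coordinate leaves the Schur complement of
  \<open>C\<close>, which by \<open>is_inv_minor\<close> is the inverse of the leading
  block.\<close>

lemma quad_inv_split:
  assumes "pd {1..Suc n} l u M" "l > 0" "u > 0"
  defines "C \<equiv> mat_inv_on {1..Suc n} M"
  shows "quad_on {1..Suc n} C w = quad_on {1..n} (mat_inv_on {1..n} M) w
     + C (Suc n) (Suc n) * (w (Suc n) + (\<Sum>i\<in>{1..n}. C (Suc n) i * w i) / C (Suc n) (Suc n))\<^sup>2"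
proof -
  let ?N = "Suc n"
  have inv: "is_inv {1..?N} M C" unfolding C_def by (rule is_inv_mat_inv_on[OF assms(1,2)])
  have pos: "C ?N ?N > 0" by (rule inv_diag_pos[OF assms(1-3) _ inv]) auto
  have sym: "C i ?N = C ?N i" if "i \<in> {1..n}" for i
    by (rule is_inv_sym[OF assms(1) _ inv]) (use that in auto)
  define S where "S = (\<Sum>i\<in>{1..n}. C ?N i * w i)"
  have pdn: "pd {1..n} l u M" by (rule pd_subset[OF assms(1)]) auto
  have "quad_on {1..n} (mat_inv_on {1..n} M) w =
      quad_on {1..n} (\<lambda>i j. C i j - C i ?N * C ?N j / C ?N ?N) w"
    by (intro quad_on_cong mat_inv_on_eq[OF pdn assms(2)] is_inv_minor[OF assms(1) inv])
       (use pos in auto)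
  also have "\<dots> = quad_on {1..n} C w - (\<Sum>i\<in>{1..n}. \<Sum>j\<in>{1..n}. (C ?N i * w i) * (C ?N j * w j) / C ?N ?N)"
    unfolding quad_on_def sum_subtractf[symmetric]
    by (intro sum.cong refl) (use sym in \<open>auto simp: algebra_simps diff_divide_distrib\<close>)
  also have "(\<Sum>i\<in>{1..n}. \<Sum>j\<in>{1..n}. (C ?N i * w i) * (C ?N j * w j) / C ?N ?N) = S\<^sup>2 / C ?N ?N"
    unfolding S_def power2_eq_square sum_product by (simp add: sum_divide_distrib)
  finally have 1: "quad_on {1..n} (mat_inv_on {1..n} M) w = quad_on {1..n} C w - S\<^sup>2 / C ?N ?N" .
  have 2: "quad_on {1..?N} C w = quad_on {1..n} C w + 2 * w ?N * S + C ?N ?N * (w ?N)\<^sup>2"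
    unfolding S_def by (rule quad_on_Suc) (rule sym)
  show ?thesis unfolding 1 2 S_def[symmetric] using pos
    by (simp add: power2_eq_square field_simps)
qed

text \<open>By \<open>inv_corner\<close> the corner entry is a ratio of consecutive leading minors
  of \<open>M\<close>. With \<open>quad_inv_split\<close> this factors a Gaussian density one
  coordinate at a time.\<close>

lemma det_inv_Suc:
  assumes "pd {1..Suc n} l u M" "l > 0"
  shows "det_on {1..Suc n} (mat_inv_on {1..Suc n} M) =
    mat_inv_on {1..Suc n} M (Suc n) (Suc n) * det_on {1..n} (mat_inv_on {1..n} M)"
proof -
  have pdn: "pd {1..n} l u M" by (rule pd_subset[OF assms(1)]) auto
  have "det_on {1..n} M * det_on {1..n} (mat_inv_on {1..n} M) = 1"
    by (rule det_inv[OF is_inv_mat_inv_on[OF pdn assms(2)]])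
  moreover have "det_on {1..Suc n} M * det_on {1..Suc n} (mat_inv_on {1..Suc n} M) = 1"
    by (rule det_inv[OF is_inv_mat_inv_on[OF assms]])
  ultimately show ?thesis unfolding inv_corner[OF assms]
    by (smt (verit) divide_eq_eq mult_zero_left nonzero_mult_div_cancel_left times_divide_eq_left)
qed

lemma det_on_empty [simp]: "det_on {} M = 1"
  by (simp add: det_on_def)

lemma det_inv_pos:
  assumes "pd {1..n} l u M" "l > 0" "u > 0"
  shows "det_on {1..n} (mat_inv_on {1..n} M) > 0"
  using assms(1)
proof (induction n)
  case (Suc n)
  have "pd {1..n} l u M" by (rule pd_subset[OF Suc.prems]) auto
  moreover have "mat_inv_on {1..Suc n} M (Suc n) (Suc n) > 0"
    by (rule inv_diag_pos[OF Suc.prems assms(2,3) _ is_inv_mat_inv_on[OF Suc.prems assms(2)]]) auto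
  ultimately show ?case using det_inv_Suc[OF Suc.prems assms(2)] Suc.IH by simp
qed simp

declare One_nat_def [simp del]

subsection \<open>Gaussian densities with variable covariance\<close>

abbreviation leb :: "nat set \<Rightarrow> (nat \<Rightarrow> real) measure" where
  "leb I \<equiv> PiM I (\<lambda>_. lborel)"

interpretation lebp: product_sigma_finite "\<lambda>_::nat. lborel :: real measure"
  by standard

lemma nn_integral_leb_empty: "(\<integral>\<^sup>+w. f w \<partial>leb {}) = f (\<lambda>_. undefined)"
proof -
  have "(\<integral>\<^sup>+w. f w \<partial>leb {}) = (\<integral>\<^sup>+w. f (\<lambda>_. undefined) \<partial>leb {})"
    by (rule nn_integral_cong) (simp add: space_PiM_empty)
  then show ?thesis by (simp add: space_PiM_empty)
qed

lemma nn_integral_gauss1: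
  fixes c \<mu> :: real
  assumes "c > 0"
  shows "(\<integral>\<^sup>+z. ennreal (sqrt (c / (2 * pi)) * exp (- (c * (z + \<mu>)\<^sup>2 / 2))) \<partial>lborel) = 1"
proof -
  have "sqrt (c / (2 * pi)) * exp (- (c * (z + \<mu>)\<^sup>2 / 2)) = normal_density (- \<mu>) (1 / sqrt c) z" for z
    unfolding normal_density_def using assms
    by (simp add: power_divide real_sqrt_divide)
  then show ?thesis
    using assms by (simp add: nn_integral_eq_integral)
qed

lemma nn_integral_gauss_iso:
  assumes "v > 0" "finite I"
  shows "(\<integral>\<^sup>+w. ennreal (exp (- ((\<Sum>i\<in>I. (w i)\<^sup>2) / (2 * v)))) \<partial>leb I)
    = ennreal ((2 * pi * v) powr (card I / 2))"
proof -
  have one: "(\<integral>\<^sup>+z. ennreal (exp (- (z\<^sup>2 / (2 * v)))) \<partial>lborel) = ennreal (sqrt (2 * pi * v))"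
  proof -
    have c: "sqrt (2 * pi * v) * sqrt (1 / v / (2 * pi)) = 1"
      using assms by (simp add: real_sqrt_mult[symmetric])
    have "ennreal (exp (- (z\<^sup>2 / (2 * v)))) = ennreal (sqrt (2 * pi * v)) *
        ennreal (sqrt (1 / v / (2 * pi)) * exp (- ((1 / v) * (z + 0)\<^sup>2 / 2)))" for z
      using c assms by (subst ennreal_mult[symmetric]) (simp_all add: mult.assoc[symmetric] mult.commute[of 2 v] del: real_sqrt_mult)
    then have "(\<integral>\<^sup>+z. ennreal (exp (- (z\<^sup>2 / (2 * v)))) \<partial>lborel) = ennreal (sqrt (2 * pi * v)) *
        (\<integral>\<^sup>+z. ennreal (sqrt (1 / v / (2 * pi)) * exp (- ((1 / v) * (z + 0)\<^sup>2 / 2))) \<partial>lborel)"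
      by (simp add: nn_integral_cmult)
    also have "\<dots> = ennreal (sqrt (2 * pi * v))"
      using nn_integral_gauss1[of "1 / v" 0] assms by simp
    finally show ?thesis .
  qed
  have "ennreal (exp (- ((\<Sum>i\<in>I. (w i)\<^sup>2) / (2 * v)))) = (\<Prod>i\<in>I. ennreal (exp (- ((w i)\<^sup>2 / (2 * v)))))"
    for w
    using assms by (simp add: sum_divide_distrib exp_sum prod_ennreal sum_negf[symmetric] del: minus_divide_left)
  then have "(\<integral>\<^sup>+w. ennreal (exp (- ((\<Sum>i\<in>I. (w i)\<^sup>2) / (2 * v)))) \<partial>leb I) =
      (\<Prod>i\<in>I. \<integral>\<^sup>+z. ennreal (exp (- (z\<^sup>2 / (2 * v)))) \<partial>lborel)"
    using assms by (simp add: lebp.product_nn_integral_prod[where f="\<lambda>i z. ennreal (exp (- (z\<^sup>2 / (2 * v))))"])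
  also have "\<dots> = ennreal (sqrt (2 * pi * v) ^ card I)"
    unfolding one using assms by (simp add: ennreal_power)
  also have "sqrt (2 * pi * v) ^ card I = (2 * pi * v) powr (card I / 2)"
    using assms by (simp add: powr_half_sqrt[symmetric] powr_realpow[symmetric] powr_powr)
  finally show ?thesis .
qed

lemma Qd_nonneg:
  assumes "pd {1..n} l u M" "l > 0" "u > 0"
  shows "Qd {1..n} w (mat_inv_on {1..n} M) \<ge> 0"
  using det_inv_pos[OF assms] unfolding Qd_def by simp

text \<open>The form splits by completing the square and the determinant by its corner entry; the
  last factor is the conditional normal density with precision \<open>c\<close>.\<close>

lemma Qd_Suc:
  assumes "pd {1..Suc n} l u M" "l > 0" "u > 0"
  defines "C \<equiv> mat_inv_on {1..Suc n} M"
  defines "c \<equiv> C (Suc n) (Suc n)"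
  shows "Qd {1..Suc n} w C = Qd {1..n} w (mat_inv_on {1..n} M) * (sqrt (c / (2 * pi)) *
     exp (- (c * (w (Suc n) + (\<Sum>i\<in>{1..n}. C (Suc n) i * w i) / c)\<^sup>2 / 2)))"
proof -
  have "(2 * pi) powr (- real (Suc n) / 2) = (2 * pi) powr (- real n / 2) / sqrt (2 * pi)"
  proof -
    have "- real (Suc n) / 2 = - real n / 2 - 1 / 2" by (simp add: field_simps)
    then show ?thesis by (simp only: powr_diff) (simp add: powr_half_sqrt)
  qed
  moreover have "det_on {1..Suc n} C = c * det_on {1..n} (mat_inv_on {1..n} M)"
    unfolding C_def c_def by (rule det_inv_Suc[OF assms(1,2)])
  moreover have "quad_on {1..Suc n} C w = quad_on {1..n} (mat_inv_on {1..n} M) w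
     + c * (w (Suc n) + (\<Sum>i\<in>{1..n}. C (Suc n) i * w i) / c)\<^sup>2"
    unfolding C_def c_def by (rule quad_inv_split[OF assms(1-3)])
  ultimately show ?thesis unfolding Qd_def
    by (simp add: real_sqrt_mult real_sqrt_divide exp_add[symmetric] add_divide_distrib)
qed

section \<open>Measurability of densities whose covariance varies\<close>

lemma measurable_det:
  assumes "\<And>\<omega>. A \<omega> \<in> carrier_mat n n"
    and "\<And>i j. i < n \<Longrightarrow> j < n \<Longrightarrow> (\<lambda>\<omega>. A \<omega> $$ (i, j)) \<in> borel_measurable N"
  shows "(\<lambda>\<omega>. Determinant.det (A \<omega>) :: real) \<in> borel_measurable N"
proof -
  have "(\<lambda>\<omega>. \<Sum>p\<in>{p. p permutes {0..<n}}. signof p * (\<Prod>i = 0..<n. A \<omega> $$ (i, p i))) \<in> borel_measurable N"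
  proof (intro borel_measurable_sum borel_measurable_times borel_measurable_const borel_measurable_prod)
    fix p i assume "p \<in> {p. p permutes {0..<n}}" "i \<in> {0..<n}"
    then show "(\<lambda>\<omega>. A \<omega> $$ (i, p i)) \<in> borel_measurable N"
      using assms(2) permutes_in_image[of p "{0..<n}" i] by auto
  qed
  then show ?thesis using det_def'[OF assms(1)] by simp
qed

text \<open>Although \<open>mat_inv_on\<close> is a choice, on positive definite arguments it agrees
  with Cramer's formula, a quotient of polynomials in the entries.\<close>

lemma measurable_inv:
  assumes "\<And>\<omega>. \<omega> \<in> space N \<Longrightarrow> pd {1..n} l u (M \<omega>)" "l > 0"
    and "\<And>i j. i \<in> {1..n} \<Longrightarrow> j \<in> {1..n} \<Longrightarrow> (\<lambda>\<omega>. M \<omega> i j) \<in> borel_measurable N"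
    and ij: "i \<in> {1..n}" "j \<in> {1..n}"
  shows "(\<lambda>\<omega>. mat_inv_on {1..n} (M \<omega>) i j) \<in> borel_measurable N"
proof -
  let ?T = "\<lambda>\<omega>. to_mat n (M \<omega>)"
  have 1: "mat_inv_on {1..n} (M \<omega>) i j =
      (-1) ^ (j - 1 + (i - 1)) * Determinant.det (mat_delete (?T \<omega>) (j - 1) (i - 1)) / Determinant.det (?T \<omega>)"
    if "\<omega> \<in> space N" for \<omega>
    using mat_inv_on_eq[OF assms(1)[OF that] assms(2) is_inv_adj[OF pd_det_nonzero[OF assms(1)[OF that] assms(2)]] ij] ij
    by (auto simp: adj_mat_def cofactor_def to_mat_def)
  have 2: "(\<lambda>\<omega>. Determinant.det (?T \<omega>)) \<in> borel_measurable N"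
    by (rule measurable_det[where n=n]) (use assms(3) in auto)
  have 3: "(\<lambda>\<omega>. Determinant.det (mat_delete (?T \<omega>) (j - 1) (i - 1))) \<in> borel_measurable N"
    by (rule measurable_det[where n="n - 1"])
       (use assms(3) ij in \<open>auto simp: mat_delete_def to_mat_def\<close>)
  show ?thesis using 2 3 by (subst measurable_cong[OF 1]) auto
qed

lemma measurable_det_on:
  assumes "\<And>i j. i \<in> {1..n} \<Longrightarrow> j \<in> {1..n} \<Longrightarrow> (\<lambda>\<omega>. C \<omega> i j) \<in> borel_measurable N"
  shows "(\<lambda>\<omega>. det_on {1..n} (C \<omega>)) \<in> borel_measurable N"
  unfolding det_on_to_mat by (rule measurable_det[where n=n]) (use assms in auto)

lemma measurable_Qd:
  assumes "\<And>\<omega>. \<omega> \<in> space N \<Longrightarrow> pd {1..n} l u (M \<omega>)" "l > 0"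
    and "\<And>i j. i \<in> {1..n} \<Longrightarrow> j \<in> {1..n} \<Longrightarrow> (\<lambda>\<omega>. M \<omega> i j) \<in> borel_measurable N"
    and "\<And>i. i \<in> {1..n} \<Longrightarrow> (\<lambda>\<omega>. v \<omega> i) \<in> borel_measurable N"
  shows "(\<lambda>\<omega>. Qd {1..n} (v \<omega>) (mat_inv_on {1..n} (M \<omega>))) \<in> borel_measurable N"
proof -
  have [measurable]: "(\<lambda>\<omega>. det_on {1..n} (mat_inv_on {1..n} (M \<omega>))) \<in> borel_measurable N"
    by (intro measurable_det_on measurable_inv[OF assms(1-3)])
  have [measurable]: "(\<lambda>\<omega>. quad_on {1..n} (mat_inv_on {1..n} (M \<omega>)) (v \<omega>)) \<in> borel_measurable N"
    unfolding quad_on_def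
    by (intro borel_measurable_sum borel_measurable_times assms(4) measurable_inv[OF assms(1-3)])
  show ?thesis unfolding Qd_def by measurable
qed

text \<open>Since the covariance may vary with \<open>w\<close>, \<open>Qd\<close> need not have
  mass one. But if it ignores the last coordinate, the conditional factor of \<open>Qd_Suc\<close>
  is a true normal density in that coordinate and integrates to one.\<close>

lemma Qd_marginal_Suc:
  assumes pd: "\<And>w. pd {1..Suc n} l u (M w)" and lu: "l > 0" "u > 0"
    and Mm: "\<And>i j. i \<in> {1..Suc n} \<Longrightarrow> j \<in> {1..Suc n} \<Longrightarrow> (\<lambda>w. M w i j) \<in> borel_measurable (leb {1..Suc n})"
    and fm: "f \<in> borel_measurable (leb {1..Suc n})"
    and Mi: "\<And>w z. M (w(Suc n := z)) = M w" and fi: "\<And>w z. f (w(Suc n := z)) = f w"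
  shows "(\<integral>\<^sup>+w. f w * ennreal (Qd {1..Suc n} w (mat_inv_on {1..Suc n} (M w))) \<partial>leb {1..Suc n})
    = (\<integral>\<^sup>+w. f w * ennreal (Qd {1..n} w (mat_inv_on {1..n} (M w))) \<partial>leb {1..n})"
proof -
  have ins: "{1..Suc n} = insert (Suc n) {1..n}" by auto
  have meas: "(\<lambda>w. f w * ennreal (Qd {1..Suc n} w (mat_inv_on {1..Suc n} (M w))))
      \<in> borel_measurable (leb {1..Suc n})"
    by (intro borel_measurable_times_ennreal fm measurable_compose[OF _ measurable_ennreal]
        measurable_Qd[OF pd lu(1) Mm]) auto
  have inner: "(\<integral>\<^sup>+z. f (w(Suc n := z)) * ennreal (Qd {1..Suc n} (w(Suc n := z))
      (mat_inv_on {1..Suc n} (M (w(Suc n := z))))) \<partial>lborel)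
    = f w * ennreal (Qd {1..n} w (mat_inv_on {1..n} (M w)))" for w
  proof -
    define C where "C = mat_inv_on {1..Suc n} (M w)"
    define c where "c = C (Suc n) (Suc n)"
    define \<mu> where "\<mu> = (\<Sum>i\<in>{1..n}. C (Suc n) i * w i) / c"
    have cpos: "c > 0" unfolding c_def C_def
      by (rule inv_diag_pos[OF pd lu _ is_inv_mat_inv_on[OF pd lu(1)]]) auto
    have pdn: "pd {1..n} l u (M w)" by (rule pd_subset[OF pd]) auto
    have s: "(\<Sum>i\<in>{1..n}. C (Suc n) i * (w(Suc n := z)) i) / c = \<mu>" for z
      unfolding \<mu>_def by (intro arg_cong2[where f="(/)"] sum.cong refl) auto
    have q: "Qd {1..n} (w(Suc n := z)) (mat_inv_on {1..n} (M w)) = Qd {1..n} w (mat_inv_on {1..n} (M w))" for z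
      by (rule Qd_cong) auto
    have "Qd {1..Suc n} (w(Suc n := z)) C = Qd {1..n} w (mat_inv_on {1..n} (M w)) *
        (sqrt (c / (2 * pi)) * exp (- (c * (z + \<mu>)\<^sup>2 / 2)))" for z
      using Qd_Suc[OF pd[of w] lu, of "w(Suc n := z)"] s[of z] unfolding C_def[symmetric] c_def[symmetric] q
      by simp
    then have "(\<integral>\<^sup>+z. f (w(Suc n := z)) * ennreal (Qd {1..Suc n} (w(Suc n := z))
        (mat_inv_on {1..Suc n} (M (w(Suc n := z))))) \<partial>lborel) =
        (\<integral>\<^sup>+z. (f w * ennreal (Qd {1..n} w (mat_inv_on {1..n} (M w)))) *
          ennreal (sqrt (c / (2 * pi)) * exp (- (c * (z + \<mu>)\<^sup>2 / 2))) \<partial>lborel)"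
      unfolding Mi fi C_def[symmetric]
      using Qd_nonneg[OF pdn lu] cpos by (simp add: ennreal_mult mult.assoc)
    also have "\<dots> = f w * ennreal (Qd {1..n} w (mat_inv_on {1..n} (M w)))"
      using nn_integral_gauss1[OF cpos, of \<mu>] by (simp add: nn_integral_cmult)
    finally show ?thesis .
  qed
  show ?thesis
    using lebp.product_nn_integral_insert[of "{1..n}" "Suc n", OF _ _ meas[unfolded ins]]
    unfolding ins[symmetric] inner by simp
qed

text \<open>Coordinates above \<open>m\<close> are removed one at a time. Measurability is asked for
  every \<open>k\<close> because \<open>leb {1..k}\<close> is a different space for each
  \<open>k\<close>.\<close>

lemma Qd_marginal:
  assumes "m \<le> n"
    and pd: "\<And>w. pd {1..n} l u (M w)" and lu: "l > 0" "u > 0"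
    and Mm: "\<And>k i j. m \<le> k \<Longrightarrow> k \<le> n \<Longrightarrow> i \<in> {1..k} \<Longrightarrow> j \<in> {1..k} \<Longrightarrow> (\<lambda>w. M w i j) \<in> borel_measurable (leb {1..k})"
    and fm: "\<And>k. m \<le> k \<Longrightarrow> k \<le> n \<Longrightarrow> f \<in> borel_measurable (leb {1..k})"
    and Mi: "\<And>w k z. m < k \<Longrightarrow> M (w(k := z)) = M w" and fi: "\<And>w k z. m < k \<Longrightarrow> f (w(k := z)) = f w"
  shows "(\<integral>\<^sup>+w. f w * ennreal (Qd {1..n} w (mat_inv_on {1..n} (M w))) \<partial>leb {1..n})
    = (\<integral>\<^sup>+w. f w * ennreal (Qd {1..m} w (mat_inv_on {1..m} (M w))) \<partial>leb {1..m})"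
  using assms(1) pd Mm fm
proof (induction n rule: dec_induct)
  case (step n)
  have pdn: "pd {1..n} l u (M w)" for w by (rule pd_subset[OF step.prems(1)]) auto
  have "(\<integral>\<^sup>+w. f w * ennreal (Qd {1..Suc n} w (mat_inv_on {1..Suc n} (M w))) \<partial>leb {1..Suc n})
    = (\<integral>\<^sup>+w. f w * ennreal (Qd {1..n} w (mat_inv_on {1..n} (M w))) \<partial>leb {1..n})"
  proof (rule Qd_marginal_Suc[OF step.prems(1) lu])
    show "(\<lambda>w. M w i j) \<in> borel_measurable (leb {1..Suc n})"
      if "i \<in> {1..Suc n}" "j \<in> {1..Suc n}" for i j
      using step.prems(2)[of "Suc n"] step.hyps that by simp
    show "f \<in> borel_measurable (leb {1..Suc n})" using step.prems(3)[of "Suc n"] step.hyps by simp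
  qed (use step.hyps in \<open>auto intro!: Mi fi simp del: fun_upd_apply\<close>)
  also have "\<dots> = (\<integral>\<^sup>+w. f w * ennreal (Qd {1..m} w (mat_inv_on {1..m} (M w))) \<partial>leb {1..m})"
    by (rule step.IH[OF pdn]) (use step.prems in auto)
  finally show ?case .
qed simp

text \<open>A constant matrix ignores every coordinate, so marginalisation runs down to the empty
  index set, where \<open>Qd\<close> is \<open>1\<close>.\<close>

lemma Qd_total_mass:
  assumes pd: "pd {1..n} l u M" and lu: "l > 0" "u > 0"
  shows "(\<integral>\<^sup>+w. ennreal (Qd {1..n} w (mat_inv_on {1..n} M)) \<partial>leb {1..n}) = 1"
proof -
  have "(\<integral>\<^sup>+w. 1 * ennreal (Qd {1..n} w (mat_inv_on {1..n} M)) \<partial>leb {1..n})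
    = (\<integral>\<^sup>+w. 1 * ennreal (Qd {1..0} w (mat_inv_on {1..0} M)) \<partial>leb {1..0})"
    by (rule Qd_marginal[OF _ pd lu]) auto
  also have "\<dots> = 1" by (simp add: Qd_def quad_on_def space_PiM_empty)
  finally show ?thesis by simp
qed

text \<open>Total mass one, read as a formula for the normalising constant. \<open>C\<close> is any
  inverse because the lemma is later applied to a rescaled one.\<close>

lemma Qd_normalizer:
  assumes "pd {1..n} l u M" "l > 0" "u > 0" "is_inv {1..n} M C"
  shows "ennreal ((2 * pi) powr (- real n / 2) * sqrt (det_on {1..n} C)) *
     (\<integral>\<^sup>+w. ennreal (exp (- quad_on {1..n} C w / 2)) \<partial>leb {1..n}) = 1"
proof -
  have eq: "Qd {1..n} w (mat_inv_on {1..n} M) = Qd {1..n} w C" for w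
    by (intro Qd_cong mat_inv_on_eq[OF assms(1,2,4)]) auto
  have d: "det_on {1..n} C > 0"
    using det_inv_pos[OF assms(1-3)] det_on_cong[of "{1..n}" "mat_inv_on {1..n} M" C]
      mat_inv_on_eq[OF assms(1,2,4)] by auto
  have [measurable]: "(\<lambda>w. quad_on {1..n} C w) \<in> borel_measurable (leb {1..n})"
    unfolding quad_on_def by measurable
  have [measurable]: "(\<lambda>w. ennreal (exp (- quad_on {1..n} C w / 2))) \<in> borel_measurable (leb {1..n})"
    by measurable
  have "ennreal ((2 * pi) powr (- real n / 2) * sqrt (det_on {1..n} C)) *
     (\<integral>\<^sup>+w. ennreal (exp (- quad_on {1..n} C w / 2)) \<partial>leb {1..n})
     = (\<integral>\<^sup>+w. ennreal (Qd {1..n} w C) \<partial>leb {1..n})"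
    unfolding Qd_def card_atLeastAtMost diff_Suc_1 Suc_eq_plus1[symmetric]
    by (simp add: ennreal_mult'' nn_integral_cmult[symmetric])
  then show ?thesis using Qd_total_mass[OF assms(1-3)] unfolding eq by simp
qed

section \<open>Comparison of Gaussian densities\<close>

lemma det_on_scale:
  assumes "finite I"
  shows "det_on I (\<lambda>i j. s i * C i j * s j) = (\<Prod>i\<in>I. s i)\<^sup>2 * det_on I C"
proof -
  have "(\<Prod>i\<in>I. s i * C i (q i) * s (q i)) = (\<Prod>i\<in>I. s i)\<^sup>2 * (\<Prod>i\<in>I. C i (q i))" if "q permutes I" for q
    using prod.permute[OF that, of s] by (simp add: prod.distrib power2_eq_square o_def mult_ac)
  then show ?thesis unfolding det_on_def sum_distrib_left by (intro sum.cong refl) (auto simp: mult_ac)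
qed

text \<open>The exponent is bounded through \<open>u\<close>. The normalising constant is bounded
  through \<open>l\<close>, by comparing the integral in \<open>Qd_normalizer\<close> with that of
  the isotropic Gaussian of variance \<open>l\<close>.\<close>

lemma Qd_le_gauss:
  assumes "pd {1..n} l u M" "l > 0" "u > 0"
  shows "Qd {1..n} w (mat_inv_on {1..n} M) \<le>
    (2 * pi * l) powr (- real n / 2) * exp (- ((\<Sum>i\<in>{1..n}. (w i)\<^sup>2) / (2 * u)))"
proof -
  define C where "C = mat_inv_on {1..n} M"
  define k where "k = (2 * pi) powr (- real n / 2) * sqrt (det_on {1..n} C)"
  have inv: "is_inv {1..n} M C" unfolding C_def by (rule is_inv_mat_inv_on[OF assms(1,2)])
  have k0: "k \<ge> 0" unfolding k_def C_def using det_inv_pos[OF assms] by simp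
  note b = quad_inv_bounds[OF assms _ inv, simplified]
  have "ennreal k * (\<integral>\<^sup>+w. ennreal (exp (- ((\<Sum>i\<in>{1..n}. (w i)\<^sup>2) / (2 * l)))) \<partial>leb {1..n}) \<le>
      ennreal k * (\<integral>\<^sup>+w. ennreal (exp (- quad_on {1..n} C w / 2)) \<partial>leb {1..n})"
  proof (intro mult_left_mono nn_integral_mono ennreal_leI)
    fix w show "exp (- ((\<Sum>i\<in>{1..n}. (w i)\<^sup>2) / (2 * l))) \<le> exp (- quad_on {1..n} C w / 2)"
      using b(1)[of w] by (simp add: field_simps)
  qed auto
  also have "\<dots> = 1" unfolding k_def by (rule Qd_normalizer[OF assms inv])
  finally have "ennreal (k * (2 * pi * l) powr (real n / 2)) \<le> 1"
    using nn_integral_gauss_iso[of l "{1..n}"] assms k0 by (simp add: ennreal_mult')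
  then have "k * (2 * pi * l) powr (real n / 2) \<le> 1"
    by simp
  then have k: "k \<le> (2 * pi * l) powr (- real n / 2)"
    using assms by (simp add: powr_minus field_simps)
  have "exp (- quad_on {1..n} C w / 2) \<le> exp (- ((\<Sum>i\<in>{1..n}. (w i)\<^sup>2) / (2 * u)))"
    using b(2)[of w] by (simp add: field_simps)
  then show ?thesis using k k0 unfolding C_def[symmetric] Qd_def k_def
    by (simp add: mult_mono)
qed

lemma is_inv_scale:
  assumes "is_inv I M C" "k \<noteq> 0"
  shows "is_inv I (\<lambda>i j. M i j / k) (\<lambda>i j. k * C i j)"
  using assms unfolding is_inv_def by simp

lemma quad_on_scale: "quad_on I (\<lambda>i j. k * C i j) w = k * quad_on I C w"
  unfolding quad_on_def sum_distrib_left by (simp add: mult_ac)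

text \<open>The ratio of the two normalising constants is bounded by comparing total masses, which avoids
  monotonicity of the determinant in the Loewner order.\<close>

lemma Qd_compare:
  assumes pd1: "pd {1..n} l u M1" and pd2: "pd {1..n} l u M2" and lu: "l > 0" "u > 0" and k: "k \<ge> 1"
    and le1: "\<And>v. quad_on {1..n} M1 v \<le> k * quad_on {1..n} M2 v"
    and le2: "\<And>v. quad_on {1..n} M2 v \<le> k * quad_on {1..n} M1 v"
  shows "Qd {1..n} w (mat_inv_on {1..n} M1) \<le>
    k powr (n / 2) * exp ((k - 1) * (\<Sum>i\<in>{1..n}. (w i)\<^sup>2) / (2 * l)) * Qd {1..n} w (mat_inv_on {1..n} M2)"
proof -
  let ?I = "{1..n}"
  define C1 where "C1 = mat_inv_on ?I M1"
  define C2 where "C2 = mat_inv_on ?I M2"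
  have inv1: "is_inv ?I M1 C1" unfolding C1_def by (rule is_inv_mat_inv_on[OF pd1 lu(1)])
  have inv2: "is_inv ?I M2 C2" unfolding C2_def by (rule is_inv_mat_inv_on[OF pd2 lu(1)])
  have d1: "det_on ?I C1 > 0" unfolding C1_def by (rule det_inv_pos[OF pd1 lu])
  have d2: "det_on ?I C2 > 0" unfolding C2_def by (rule det_inv_pos[OF pd2 lu])
  have q21: "quad_on ?I C2 v \<le> k * quad_on ?I C1 v" for v
    by (rule quad_inv_antimono[OF pd1 _ _ inv1 inv2 _ le1]) (use lu k in auto)
  have q12: "quad_on ?I C1 v \<le> k * quad_on ?I C2 v" for v
    by (rule quad_inv_antimono[OF pd2 _ _ inv2 inv1 _ le2]) (use lu k in auto)
  \<comment> \<open>The precision \<open>k * C2\<close> dominates \<open>C1\<close> and is inverse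
    to \<open>M2 / k\<close>, so its normalising constant is that of \<open>C2\<close> times
    \<open>k powr (n / 2)\<close>.\<close>
  let ?D = "\<lambda>i j. k * C2 i j"
  define \<kappa>1 where "\<kappa>1 = (2 * pi) powr (- real n / 2) * sqrt (det_on ?I C1)"
  define \<kappa>2 where "\<kappa>2 = (2 * pi) powr (- real n / 2) * sqrt (det_on ?I C2)"
  have invD: "is_inv ?I (\<lambda>i j. M2 i j / k) ?D" using inv2 k by (intro is_inv_scale) auto
  have pdD: "pd ?I (l / k) (u / k) (\<lambda>i j. M2 i j / k)"
    using pd2 quad_on_scale[of ?I "1/k" M2] k unfolding pd_def
    by (auto simp: divide_simps)
  have "det_on ?I ?D = det_on ?I (\<lambda>i j. sqrt k * C2 i j * sqrt k)"
  proof -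
    have "sqrt k * x * sqrt k = k * x" for x
    proof -
      have "sqrt k * x * sqrt k = (sqrt k * sqrt k) * x" by (simp only: mult_ac)
      also have "\<dots> = k * x" using k by simp
      finally show ?thesis .
    qed
    then show ?thesis by (simp only:)
  qed
  also have "\<dots> = k ^ n * det_on ?I C2"
  proof -
    have "(sqrt k ^ n)\<^sup>2 = ((sqrt k)\<^sup>2) ^ n" by (simp only: power_mult[symmetric] mult.commute)
    then show ?thesis using det_on_scale[of ?I "\<lambda>_. sqrt k" C2] k by simp
  qed
  finally have detD: "det_on ?I ?D = k ^ n * det_on ?I C2" .
  have "sqrt (k ^ n) = k powr (n / 2)"
    using k by (simp add: powr_half_sqrt[symmetric] powr_realpow[symmetric] powr_powr)
  then have \<kappa>D: "(2 * pi) powr (- real n / 2) * sqrt (det_on ?I ?D) = k powr (n / 2) * \<kappa>2"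
    unfolding detD \<kappa>2_def by (simp add: real_sqrt_mult)
  let ?J = "\<integral>\<^sup>+w. ennreal (exp (- quad_on ?I ?D w / 2)) \<partial>leb ?I"
  have J: "ennreal (k powr (n / 2) * \<kappa>2) * ?J = 1"
    using Qd_normalizer[OF pdD _ _ invD] lu k unfolding \<kappa>D by simp
  \<comment> \<open>By \<open>q12\<close> the integrand of \<open>?J\<close> is at most that of
    \<open>C1\<close>, whose integral times \<open>\<kappa>1\<close> is one; multiplying by the
    normaliser of \<open>?D\<close> then bounds \<open>\<kappa>1\<close>.\<close>
  have "ennreal \<kappa>1 * ?J \<le> ennreal \<kappa>1 * (\<integral>\<^sup>+w. ennreal (exp (- quad_on ?I C1 w / 2)) \<partial>leb ?I)"
    using q12 by (intro mult_left_mono nn_integral_mono ennreal_leI) (auto simp: quad_on_scale)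
  also have "\<dots> = 1" unfolding \<kappa>1_def by (rule Qd_normalizer[OF pd1 lu inv1])
  finally have "ennreal \<kappa>1 * ?J \<le> 1" .
  then have "ennreal (k powr (n / 2) * \<kappa>2) * (ennreal \<kappa>1 * ?J) \<le> ennreal (k powr (n / 2) * \<kappa>2) * 1"
    by (rule mult_left_mono) simp
  then have "ennreal \<kappa>1 \<le> ennreal (k powr (n / 2) * \<kappa>2)"
    using J by (simp add: mult.left_commute)
  then have \<kappa>: "\<kappa>1 \<le> k powr (n / 2) * \<kappa>2"
    using d2 k unfolding \<kappa>2_def by (subst (asm) ennreal_le_iff) auto
  define S where "S = (\<Sum>i\<in>?I. (w i)\<^sup>2)"
  have "quad_on ?I C2 w \<le> S / l" unfolding S_def by (rule quad_inv_bounds(1)[OF pd2 lu _ inv2]) simp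
  have q0: "0 \<le> quad_on ?I C2 w"
    using quad_inv_bounds(2)[OF pd2 lu _ inv2, of w] lu
    by (smt (verit) divide_nonneg_pos finite_atLeastAtMost sum_nonneg zero_le_power2)
  have aux: "- q1 / 2 \<le> Y + - q2 / 2" if "a \<le> X" "b \<le> q1" "a + b = q2" "Y = X / 2"
    for a b X Y q1 q2 :: real using that by linarith
  have "(k - 1) * quad_on ?I C2 w \<le> (k - 1) * (S / l)"
    using k \<open>quad_on ?I C2 w \<le> S / l\<close> by (intro mult_left_mono) auto
  \<comment> \<open>From \<open>(k - 1)\<^sup>2 \<ge> 0\<close> comes
    \<open>2 - k \<le> 1 / k\<close>. This linearises the comparison of exponents, so the loss is
    only \<open>(k - 1) / 2\<close> times the form of \<open>C2\<close>.\<close>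
  moreover have "(2 - k) * quad_on ?I C2 w \<le> quad_on ?I C1 w"
  proof -
    have "(2 - k) * k \<le> 1" using zero_le_power2[of "k - 1"] by (simp add: power2_eq_square algebra_simps)
    then have "2 - k \<le> 1 / k" using k by (simp add: field_simps)
    then have "(2 - k) * quad_on ?I C2 w \<le> 1 / k * quad_on ?I C2 w" using q0 by (rule mult_right_mono)
    also have "\<dots> \<le> quad_on ?I C1 w" using q21[of w] k by (simp add: field_simps)
    finally show ?thesis .
  qed
  moreover have "(k - 1) * quad_on ?I C2 w + (2 - k) * quad_on ?I C2 w = quad_on ?I C2 w"
    by (simp add: algebra_simps)
  moreover have "(k - 1) * S / (2 * l) = (k - 1) * (S / l) / 2" by simp
  ultimately have "- quad_on ?I C1 w / 2 \<le> (k - 1) * S / (2 * l) + - quad_on ?I C2 w / 2"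
    by (rule aux)
  then have "exp (- quad_on ?I C1 w / 2) \<le> exp ((k - 1) * S / (2 * l)) * exp (- quad_on ?I C2 w / 2)"
    by (simp add: exp_add[symmetric])
  then have "\<kappa>1 * exp (- quad_on ?I C1 w / 2) \<le>
      (k powr (n / 2) * \<kappa>2) * (exp ((k - 1) * S / (2 * l)) * exp (- quad_on ?I C2 w / 2))"
    using d2 by (intro mult_mono[OF \<kappa>]) (auto simp: \<kappa>2_def)
  then show ?thesis unfolding Qd_def C1_def[symmetric] C2_def[symmetric] \<kappa>1_def \<kappa>2_def S_def
    by (simp add: mult_ac)
qed

text \<open>A one-dimensional affine substitution in each coordinate, combined by Tonelli; the
  Jacobian is the product of the scales.\<close>

lemma nn_integral_PiM_affine:
  fixes c t :: "nat \<Rightarrow> real"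
  assumes "finite I" "\<And>i. i \<in> I \<Longrightarrow> c i > 0" "f \<in> borel_measurable (leb I)"
  shows "(\<integral>\<^sup>+y. f y \<partial>leb I) = ennreal (\<Prod>i\<in>I. c i) *
     (\<integral>\<^sup>+w. f (restrict (\<lambda>i. t i + c i * w i) I) \<partial>leb I)"
  using assms
proof (induction I arbitrary: f rule: finite_induct)
  case empty
  show ?case unfolding nn_integral_leb_empty by (simp add: restrict_def)
next
  case (insert i I)
  note [measurable] = insert.prems(2)
  have ci: "c i > 0" using insert by simp
  \<comment> \<open>The coordinate \<open>i\<close>, already substituted, is integrated inside
    \<open>h\<close>, so the induction hypothesis applies to \<open>h\<close> on
    \<open>I\<close>.\<close>
  define h where "h = (\<lambda>x. \<integral>\<^sup>+z. f (x(i := t i + c i * z)) \<partial>lborel)"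
  have upd: "(\<lambda>(x, z). x(i := t i + c i * z)) \<in> leb I \<Otimes>\<^sub>M lborel \<rightarrow>\<^sub>M leb (insert i I)"
    by measurable
  have [measurable]: "h \<in> borel_measurable (leb I)"
    unfolding h_def
    by (rule lborel.borel_measurable_nn_integral)
       (use measurable_compose[OF upd insert.prems(2)] in \<open>simp add: case_prod_unfold\<close>)
  have "(\<integral>\<^sup>+y. f y \<partial>leb (insert i I)) = (\<integral>\<^sup>+x. \<integral>\<^sup>+z. f (x(i := z)) \<partial>lborel \<partial>leb I)"
    by (rule lebp.product_nn_integral_insert) (use insert.hyps insert.prems(2) in auto)
  also have "\<dots> = (\<integral>\<^sup>+x. ennreal (c i) * h x \<partial>leb I)"
  proof (rule nn_integral_cong)
    fix x assume x: "x \<in> space (leb I)"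
    have "(\<lambda>z. x(i := z)) \<in> borel \<rightarrow>\<^sub>M leb (insert i I)"
      using x by measurable
    then have "(\<lambda>z. f (x(i := z))) \<in> borel_measurable borel"
      by (rule measurable_compose) (rule insert.prems(2))
    from nn_integral_real_affine[OF this, of "c i" "t i"] ci
    show "(\<integral>\<^sup>+z. f (x(i := z)) \<partial>lborel) = ennreal (c i) * h x"
      unfolding h_def by simp
  qed
  also have "\<dots> = ennreal (c i) * (\<integral>\<^sup>+x. h x \<partial>leb I)" by (rule nn_integral_cmult) simp
  also have "\<dots> = ennreal (c i) * (ennreal (\<Prod>i\<in>I. c i) * (\<integral>\<^sup>+w. h (restrict (\<lambda>i. t i + c i * w i) I) \<partial>leb I))"
  proof -
    have "(\<integral>\<^sup>+x. h x \<partial>leb I) =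
        ennreal (\<Prod>i\<in>I. c i) * (\<integral>\<^sup>+w. h (restrict (\<lambda>i. t i + c i * w i) I) \<partial>leb I)"
      by (rule insert.IH) (use insert.prems(1) in auto)
    then show ?thesis by (rule arg_cong)
  qed
  also have "\<dots> = ennreal (\<Prod>i\<in>insert i I. c i) * (\<integral>\<^sup>+w. h (restrict (\<lambda>i. t i + c i * w i) I) \<partial>leb I)"
  proof -
    have "(\<Prod>i\<in>I. c i) \<ge> 0" using insert.prems(1) by (intro prod_nonneg) (simp add: less_imp_le)
    then show ?thesis using insert.hyps ci by (simp add: ennreal_mult mult.assoc)
  qed
  also have "(\<integral>\<^sup>+w. h (restrict (\<lambda>i. t i + c i * w i) I) \<partial>leb I) =
      (\<integral>\<^sup>+x. \<integral>\<^sup>+z. f (restrict (\<lambda>k. t k + c k * (x(i := z)) k) (insert i I)) \<partial>lborel \<partial>leb I)"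
  proof -
    have "(restrict (\<lambda>i. t i + c i * x i) I)(i := t i + c i * z) =
        restrict (\<lambda>k. t k + c k * (x(i := z)) k) (insert i I)" for x z
      using insert.hyps(2) by (auto simp: restrict_def fun_eq_iff)
    then show ?thesis unfolding h_def by simp
  qed
  also have "\<dots> = (\<integral>\<^sup>+w. f (restrict (\<lambda>k. t k + c k * w k) (insert i I)) \<partial>leb (insert i I))"
    by (rule lebp.product_nn_integral_insert[symmetric]) (use insert.hyps in auto)
  finally show ?case .
qed

subsection \<open>The rescaled covariance matrices\<close>

text \<open>One instance is fixed, with \<open>K\<close>, \<open>t\<close> and \<open>x\<close> as
  parameters; a constant is uniform when it does not mention them.\<close>

locale ou_setting =
  fixes L0 L1 kl \<alpha> \<beta> kb :: real and K :: nat and lam :: "nat \<Rightarrow> real"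
    and a :: "(nat \<Rightarrow> real) \<Rightarrow> nat \<Rightarrow> nat \<Rightarrow> real" and t :: real and x :: "nat \<Rightarrow> real"
  assumes L0: "0 < L0" and L01: "L0 \<le> L1" and kl: "0 < kl"
    and al0: "0 < \<alpha>" and al1: "\<alpha> \<le> 1" and be0: "0 < \<beta>"
    and setting: "setting L0 L1 kl \<alpha> \<beta> kb K lam a" and t: "t > 0"
begin

abbreviation "g \<equiv> gd lam t"

text \<open>Exponentials normalised to norm one in L^2(0,t); \<open>rho\<close> is their Gram
  matrix.\<close>

definition h :: "nat \<Rightarrow> real \<Rightarrow> real" where
  "h i s = sqrt (Gd lam t i) * exp (- lam i * s)"

definition rho :: "nat \<Rightarrow> nat \<Rightarrow> real" where
  "rho i j = sqrt (Gd lam t i) * integral {0..t} (\<lambda>s. exp (- (lam i + lam j) * s)) * sqrt (Gd lam t j)"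

text \<open>Encodes both \<open>yof\<close> (at \<open>m = K\<close>) and \<open>pim\<close> applied
  to it: coordinates beyond \<open>m\<close> stay at \<open>x'\<close>, so \<open>w\<close> ranges
  over one type for all \<open>m\<close>.\<close>

definition ym :: "nat \<Rightarrow> (nat \<Rightarrow> real) \<Rightarrow> nat \<Rightarrow> real" where
  "ym m w = restrict (\<lambda>i. xp lam t x i + (if i \<in> {1..m} then sqrt (g i) * w i else 0)) {1..K}"

text \<open>The covariance rescaled by \<open>G\<close> on both sides, as a Schur product with
  \<open>rho\<close>; its inverse on \<open>{1..m}\<close> is \<open>Atm\<close>.\<close>

definition bm :: "nat \<Rightarrow> (nat \<Rightarrow> real) \<Rightarrow> nat \<Rightarrow> nat \<Rightarrow> real" where
  "bm m w i j = a (ym m w) i j * rho i j"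

lemma L1_pos: "L1 > 0" using L0 L01 by linarith

lemma lam_lower:
  assumes "i \<in> {1..K}"
  shows "kl * (real i)\<^sup>2 \<le> lam i"
proof -
  have "\<forall>i\<in>{1..K}. kl * real i ^ 2 \<le> lam i \<and> lam i \<le> real i ^ 2 / kl"
    using setting unfolding setting_def by (elim conjE)
  then show ?thesis using assms by simp
qed

lemma a_sym:
  assumes "y \<in> PiE {1..K} (\<lambda>_. UNIV)" "i \<in> {1..K}" "j \<in> {1..K}"
  shows "a y i j = a y j i"
proof -
  have "\<forall>y\<in>PiE {1..K} (\<lambda>_. UNIV). \<forall>i\<in>{1..K}. \<forall>j\<in>{1..K}. a y i j = a y j i"
    using setting unfolding setting_def by (elim conjE)
  then show ?thesis using assms by blast
qed

lemma a_elliptic: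
  assumes "y \<in> PiE {1..K} (\<lambda>_. UNIV)"
  shows "L0 * (\<Sum>i\<in>{1..K}. (v i)\<^sup>2) \<le> (\<Sum>i\<in>{1..K}. \<Sum>j\<in>{1..K}. a y i j * v i * v j)"
    and "(\<Sum>i\<in>{1..K}. \<Sum>j\<in>{1..K}. a y i j * v i * v j) \<le> L1 * (\<Sum>i\<in>{1..K}. (v i)\<^sup>2)"
proof -
  have *: "\<forall>y\<in>PiE {1..K} (\<lambda>_. UNIV). \<forall>v::nat \<Rightarrow> real.
        L0 * (\<Sum>i\<in>{1..K}. v i ^ 2) \<le> (\<Sum>i\<in>{1..K}. \<Sum>j\<in>{1..K}. a y i j * v i * v j) \<and>
        (\<Sum>i\<in>{1..K}. \<Sum>j\<in>{1..K}. a y i j * v i * v j) \<le> L1 * (\<Sum>i\<in>{1..K}. v i ^ 2)"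
    using setting unfolding setting_def by (elim conjE)
  note ** = *[rule_format, OF assms, of v]
  show "L0 * (\<Sum>i\<in>{1..K}. (v i)\<^sup>2) \<le> (\<Sum>i\<in>{1..K}. \<Sum>j\<in>{1..K}. a y i j * v i * v j)"
    using ** by (rule conjunct1)
  show "(\<Sum>i\<in>{1..K}. \<Sum>j\<in>{1..K}. a y i j * v i * v j) \<le> L1 * (\<Sum>i\<in>{1..K}. (v i)\<^sup>2)"
    using ** by (rule conjunct2)
qed

lemma a_holder:
  fixes h :: real
  assumes "y \<in> PiE {1..K} (\<lambda>_. UNIV)" "i \<in> {1..K}" "j \<in> {1..K}" "k \<in> {1..K}"
  shows "\<bar>a (y(k := y k + h)) i j - a y i j\<bar> \<le> kb * \<bar>h\<bar> powr \<alpha> * real k powr (- \<beta>)"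
proof -
  have "\<forall>y\<in>PiE {1..K} (\<lambda>_. UNIV). \<forall>i\<in>{1..K}. \<forall>j\<in>{1..K}. \<forall>k\<in>{1..K}. \<forall>h::real.
        \<bar>a (y(k := y k + h)) i j - a y i j\<bar> \<le> kb * \<bar>h\<bar> powr \<alpha> * real k powr (- \<beta>)"
    using setting unfolding setting_def by (elim conjE)
  then show ?thesis using assms by blast
qed

section \<open>Decay of the variances and the Gram matrix\<close>

lemma lam_pos: "i \<in> {1..K} \<Longrightarrow> lam i > 0"
  by (rule less_le_trans[OF _ lam_lower]) (use kl in auto)

lemma g_pos: "i \<in> {1..K} \<Longrightarrow> g i > 0"
  using lam_pos[of i] t unfolding gd_def by (simp add: mult_neg_pos)

lemma G_pos: "i \<in> {1..K} \<Longrightarrow> Gd lam t i > 0"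
  using g_pos unfolding Gd_def by simp

text \<open>The quadratic growth of \<open>lam\<close> makes coordinate \<open>i\<close> move only
  by order \<open>1 / i\<close>; in the Hoelder bound this contributes the extra decay of order
  \<open>\<alpha>\<close>.\<close>

lemma sqrt_g_le:
  assumes "i \<in> {1..K}"
  shows "sqrt (g i) \<le> (1 / sqrt (2 * kl)) / real i"
proof -
  have i: "real i > 0" using assms by auto
  have "g i \<le> 1 / (2 * lam i)" using lam_pos[OF assms] unfolding gd_def by (simp add: divide_right_mono)
  also have "\<dots> \<le> 1 / (2 * (kl * (real i)\<^sup>2))"
    using lam_lower[OF assms] kl i by (intro divide_left_mono mult_left_mono mult_pos_pos) (auto intro: lam_pos[OF assms])
  finally have "sqrt (g i) \<le> sqrt (1 / (2 * (kl * (real i)\<^sup>2)))" by simp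
  also have "\<dots> = (1 / sqrt (2 * kl)) / real i" using i by (simp add: real_sqrt_divide real_sqrt_mult)
  finally show ?thesis .
qed

lemma exp_has_integral:
  assumes "c > 0"
  shows "((\<lambda>s::real. exp (- c * s)) has_integral (1 - exp (- c * t)) / c) {0..t}"
proof -
  have "((\<lambda>s. exp (- c * s)) has_integral (- exp (- c * t) / c) - (- exp (- c * 0) / c)) {0..t}"
    using assms t by (intro fundamental_theorem_of_calculus)
      (auto intro!: derivative_eq_intros simp: has_real_derivative_iff_has_vector_derivative[symmetric])
  then show ?thesis by (simp add: diff_divide_distrib)
qed

lemma h_has_integral:
  assumes "i \<in> {1..K}" "j \<in> {1..K}"
  shows "((\<lambda>s. h i s * h j s) has_integral rho i j) {0..t}"
proof -
  have c: "lam i + lam j > 0" using lam_pos assms by (simp add: add_pos_pos)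
  have "((\<lambda>s. exp (- (lam i + lam j) * s)) has_integral integral {0..t} (\<lambda>s. exp (- (lam i + lam j) * s))) {0..t}"
    using exp_has_integral[OF c] by (simp add: integrable_integral has_integral_integrable)
  then have "((\<lambda>s. (sqrt (Gd lam t i) * sqrt (Gd lam t j)) * exp (- (lam i + lam j) * s)) has_integral
      (sqrt (Gd lam t i) * sqrt (Gd lam t j)) * integral {0..t} (\<lambda>s. exp (- (lam i + lam j) * s))) {0..t}"
    by (rule has_integral_mult_right)
  moreover have "h i s * h j s = (sqrt (Gd lam t i) * sqrt (Gd lam t j)) * exp (- (lam i + lam j) * s)" for s
    unfolding h_def by (simp add: exp_add[symmetric] algebra_simps)
  ultimately show ?thesis unfolding rho_def by (simp add: mult_ac)
qed

lemma rho_diag: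
  assumes "i \<in> {1..K}"
  shows "rho i i = 1"
proof -
  have "integral {0..t} (\<lambda>s. exp (- (lam i + lam i) * s)) = g i"
    using integral_unique[OF exp_has_integral[of "lam i + lam i"]] lam_pos[OF assms]
    by (simp add: gd_def mult_ac)
  then show ?thesis using g_pos[OF assms] unfolding rho_def Gd_def
    by (simp add: field_simps real_sqrt_divide)
qed

lemma rho_sym: "rho i j = rho j i"
  unfolding rho_def by (simp add: add.commute mult.commute mult.left_commute)

text \<open>The functions \<open>h i\<close> are nonnegative with norm one, so the
  arithmetic-geometric mean inequality under the integral suffices.\<close>

lemma rho_bounds:
  assumes "i \<in> {1..K}" "j \<in> {1..K}"
  shows "0 \<le> rho i j" "rho i j \<le> 1"
proof -
  show "0 \<le> rho i j"
    by (rule has_integral_nonneg[OF h_has_integral[OF assms]])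
       (use G_pos assms in \<open>auto simp: h_def less_imp_le\<close>)
  have "((\<lambda>s. (h i s * h i s + h j s * h j s) / 2) has_integral (rho i i + rho j j) / 2) {0..t}"
    by (intro has_integral_divide has_integral_add h_has_integral assms)
  then have "rho i j \<le> (rho i i + rho j j) / 2"
  proof (rule has_integral_le[OF h_has_integral[OF assms]])
    fix s show "h i s * h j s \<le> (h i s * h i s + h j s * h j s) / 2"
      using sum_squares_bound[of "h i s" "h j s"] by (simp add: power2_eq_square)
  qed
  then show "rho i j \<le> 1" using rho_diag assms by simp
qed

lemma ym_PiE [simp]: "ym m w \<in> PiE {1..K} (\<lambda>_. UNIV)"
  unfolding ym_def by simp

text \<open>The quadratic form of a Schur product with the Gram matrix \<open>rho\<close> is an average of
  quadratic forms of \<open>a\<close>, so the ellipticity bounds are inherited.\<close>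

lemma pd_bm: "pd {1..K} L0 L1 (bm m w)"
  unfolding pd_def
proof (intro conjI allI ballI)
  fix i j assume "i \<in> {1..K}" "j \<in> {1..K}"
  then show "bm m w i j = bm m w j i" unfolding bm_def using rho_sym[of i j] a_sym[OF ym_PiE] by simp
next
  fix v :: "nat \<Rightarrow> real"
  let ?A = "a (ym m w)"
  note ell = a_elliptic[OF ym_PiE]
  have "((\<lambda>s. \<Sum>i\<in>{1..K}. \<Sum>j\<in>{1..K}. (?A i j * v i * v j) * (h i s * h j s)) has_integral
      (\<Sum>i\<in>{1..K}. \<Sum>j\<in>{1..K}. (?A i j * v i * v j) * rho i j)) {0..t}"
    by (intro has_integral_sum has_integral_mult_right h_has_integral) auto
  then have 1: "((\<lambda>s. \<Sum>i\<in>{1..K}. \<Sum>j\<in>{1..K}. ?A i j * (v i * h i s) * (v j * h j s)) has_integral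
      quad_on {1..K} (bm m w) v) {0..t}"
    unfolding quad_on_def bm_def by (simp add: mult_ac)
  \<comment> \<open>Since \<open>rho i i = 1\<close>, the squared norms of the test vectors
    \<open>v i * h i s\<close> integrate back to that of \<open>v\<close>, so both bounds survive
    unchanged.\<close>
  have "((\<lambda>s. \<Sum>i\<in>{1..K}. (v i)\<^sup>2 * (h i s * h i s)) has_integral (\<Sum>i\<in>{1..K}. (v i)\<^sup>2 * rho i i)) {0..t}"
    by (intro has_integral_sum has_integral_mult_right h_has_integral) auto
  then have 2: "((\<lambda>s. \<Sum>i\<in>{1..K}. (v i * h i s)\<^sup>2) has_integral (\<Sum>i\<in>{1..K}. (v i)\<^sup>2)) {0..t}"
    using rho_diag by (simp add: power2_eq_square mult_ac)
  show "L0 * (\<Sum>i\<in>{1..K}. (v i)\<^sup>2) \<le> quad_on {1..K} (bm m w) v"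
    by (rule has_integral_le[OF has_integral_mult_right[OF 2] 1]) (rule ell)
  show "quad_on {1..K} (bm m w) v \<le> L1 * (\<Sum>i\<in>{1..K}. (v i)\<^sup>2)"
    by (rule has_integral_le[OF 1 has_integral_mult_right[OF 2]]) (rule ell)
qed

lemma pd_bm': "n \<le> K \<Longrightarrow> pd {1..n} L0 L1 (bm m w)"
  by (rule pd_subset[OF pd_bm]) auto

text \<open>The coordinates of \<open>y\<close> are replaced by those of \<open>y'\<close> one at a
  time, \<open>override_on\<close> being the intermediate point.\<close>

lemma holder:
  assumes "y \<in> PiE {1..K} (\<lambda>_. UNIV)" "y' \<in> PiE {1..K} (\<lambda>_. UNIV)" "i \<in> {1..K}" "j \<in> {1..K}"
  shows "\<bar>a y' i j - a y i j\<bar> \<le> (\<Sum>k\<in>{1..K}. kb * \<bar>y' k - y k\<bar> powr \<alpha> * real k powr (- \<beta>))"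
proof -
  have "\<bar>a (override_on y y' J) i j - a y i j\<bar> \<le> (\<Sum>k\<in>J. kb * \<bar>y' k - y k\<bar> powr \<alpha> * real k powr (- \<beta>))"
    if "finite J" "J \<subseteq> {1..K}" for J
    using that
  proof (induction J rule: finite_induct)
    case (insert k J)
    let ?z = "override_on y y' J"
    have z: "?z \<in> PiE {1..K} (\<lambda>_. UNIV)"
      using assms by (auto simp: override_on_def PiE_def extensional_def)
    have "override_on y y' (insert k J) = ?z(k := ?z k + (y' k - y k))"
      using insert.hyps by (auto simp: override_on_def fun_eq_iff)
    moreover have "\<bar>a (?z(k := ?z k + (y' k - y k))) i j - a ?z i j\<bar> \<le>
        kb * \<bar>y' k - y k\<bar> powr \<alpha> * real k powr (- \<beta>)"
      by (rule a_holder) (use z assms insert.prems in auto)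
    moreover have "\<bar>a ?z i j - a y i j\<bar> \<le> (\<Sum>k\<in>J. kb * \<bar>y' k - y k\<bar> powr \<alpha> * real k powr (- \<beta>))"
      using insert.IH insert.prems by simp
    ultimately show ?case unfolding sum.insert[OF insert.hyps] by (simp del: fun_upd_apply)
  qed simp
  from this[of "{1..K}"] have "\<bar>a (override_on y y' {1..K}) i j - a y i j\<bar> \<le>
      (\<Sum>k\<in>{1..K}. kb * \<bar>y' k - y k\<bar> powr \<alpha> * real k powr (- \<beta>))" by simp
  moreover have "override_on y y' {1..K} = y'"
    using assms by (auto simp: override_on_def fun_eq_iff PiE_def extensional_def)
  ultimately show ?thesis by simp
qed

text \<open>Serves measurability. In the product topology the right side of \<open>holder\<close>, a
  sum over finitely many coordinates, tends to zero.\<close>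

lemma continuous_a:
  assumes "i \<in> {1..K}" "j \<in> {1..K}"
  shows "continuous_on UNIV (\<lambda>v::nat \<Rightarrow> real. a (restrict v {1..K}) i j)"
  unfolding continuous_on_def
proof
  fix v :: "nat \<Rightarrow> real"
  let ?F = "\<lambda>v. a (restrict v {1..K}) i j"
  let ?B = "\<lambda>u. \<Sum>k\<in>{1..K}. kb * \<bar>u k - v k\<bar> powr \<alpha> * real k powr (- \<beta>)"
  have bound: "\<bar>?F u - ?F v\<bar> \<le> ?B u" for u
    using holder[of "restrict v {1..K}" "restrict u {1..K}" i j] assms by simp
  have coord: "((\<lambda>u. u k) \<longlongrightarrow> v k) (at v)" for k :: nat
    using continuous_on_product_coordinates[of k, where 'b=real] unfolding continuous_on_def by auto
  have "((\<lambda>u. kb * \<bar>u k - v k\<bar> powr \<alpha> * real k powr (- \<beta>)) \<longlongrightarrow> kb * 0 * real k powr (- \<beta>)) (at v)" for k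
  proof (intro tendsto_intros)
    have "((\<lambda>u. \<bar>u k - v k\<bar>) \<longlongrightarrow> \<bar>v k - v k\<bar>) (at v)" by (intro tendsto_intros coord)
    then have 1: "((\<lambda>u. \<bar>u k - v k\<bar>) \<longlongrightarrow> 0) (at v)" by simp
    show "((\<lambda>u. \<bar>u k - v k\<bar> powr \<alpha>) \<longlongrightarrow> 0) (at v)"
      using tendsto_powr'[OF 1 tendsto_const[of \<alpha>]] al0 by auto
  qed
  then have "(?B \<longlongrightarrow> (\<Sum>k\<in>{1..K}. kb * 0 * real k powr (- \<beta>))) (at v)" by (intro tendsto_sum)
  then have "(?B \<longlongrightarrow> 0) (at v)" by simp
  then have "((\<lambda>u. ?F u - ?F v) \<longlongrightarrow> 0) (at v)"
    by (rule Lim_null_comparison[rotated]) (use bound in \<open>auto intro!: always_eventually\<close>)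
  then show "(?F \<longlongrightarrow> ?F v) (at v within UNIV)" by (simp add: LIM_zero_cancel)
qed

lemma measurable_bm:
  assumes "i \<in> {1..K}" "j \<in> {1..K}" "\<And>k. k \<in> {1..m} \<Longrightarrow> (\<lambda>\<omega>. v \<omega> k) \<in> borel_measurable N"
  shows "(\<lambda>\<omega>. bm m (v \<omega>) i j) \<in> borel_measurable N"
proof -
  let ?y = "\<lambda>\<omega> k. xp lam t x k + (if k \<in> {1..m} then sqrt (g k) * v \<omega> k else 0)"
  have "?y \<in> borel_measurable N"
  proof (rule measurable_coordinatewise_then_product)
    fix k show "(\<lambda>\<omega>. ?y \<omega> k) \<in> borel_measurable N"
      using assms(3)[of k] by (cases "k \<in> {1..m}") auto
  qed
  then have "(\<lambda>\<omega>. a (restrict (?y \<omega>) {1..K}) i j) \<in> borel_measurable N"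
    by (rule measurable_compose) (rule borel_measurable_continuous_onI[OF continuous_a[OF assms(1,2)]])
  then show ?thesis unfolding bm_def ym_def by simp
qed

text \<open>\<open>v\<close> is general because the lemma is applied to \<open>w\<close> itself and
  to the rescaled displacement of \<open>y\<close> from \<open>x'\<close>.\<close>

lemma measurable_Qd_bm:
  assumes "n \<le> K" "m \<le> n" "\<And>k. k \<in> {1..n} \<Longrightarrow> (\<lambda>\<omega>. v \<omega> k) \<in> borel_measurable N"
  shows "(\<lambda>\<omega>. Qd {1..n} (v \<omega>) (mat_inv_on {1..n} (bm m (v \<omega>)))) \<in> borel_measurable N"
  by (rule measurable_Qd[OF pd_bm'[OF assms(1)] L0 measurable_bm]) (use assms in auto)

lemma ym_upd: "m < k \<Longrightarrow> ym m (w(k := z)) = ym m w"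
  unfolding ym_def by (auto simp: fun_eq_iff restrict_def)

text \<open>\<open>bm m\<close> is frozen beyond coordinate \<open>m\<close>, so the remaining
  coordinates integrate out exactly.\<close>

lemma marginal_bm:
  assumes "m \<le> n" "n \<le> K" "1 \<le> j" "j \<le> m" "f \<in> borel_measurable borel"
  shows "(\<integral>\<^sup>+w. f (w j) * ennreal (Qd {1..n} w (mat_inv_on {1..n} (bm m w))) \<partial>leb {1..n})
    = (\<integral>\<^sup>+w. f (w j) * ennreal (Qd {1..m} w (mat_inv_on {1..m} (bm m w))) \<partial>leb {1..m})"
proof (rule Qd_marginal[OF assms(1) pd_bm'[OF assms(2)] L0 L1_pos])
  fix k i l assume k: "m \<le> k" "k \<le> n"
  { assume "i \<in> {1..k}" "l \<in> {1..k}"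
    then show "(\<lambda>w. bm m w i l) \<in> borel_measurable (leb {1..k})"
      using k assms by (intro measurable_bm) auto }
  show "(\<lambda>w. f (w j)) \<in> borel_measurable (leb {1..k})"
    using k assms by (intro measurable_compose[OF _ assms(5)]) auto
next
  fix w :: "nat \<Rightarrow> real" and k :: nat and z :: real
  assume k: "m < k"
  then show "bm m (w(k := z)) = bm m w" unfolding bm_def by (simp add: ym_upd)
  show "f ((w(k := z)) j) = f (w j)" using k assms by auto
qed

subsection \<open>Comparison over one dyadic block\<close>

text \<open>Trades the Hoelder power for a square, so that a block sum is controlled by its length
  and the squared norm of \<open>w\<close>.\<close>

lemma abs_powr_le: "\<bar>z::real\<bar> powr \<alpha> \<le> 1 + z\<^sup>2"
proof (cases "\<bar>z\<bar> \<le> 1")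
  case True
  then have "\<bar>z\<bar> powr \<alpha> \<le> 1" using al0 by (intro powr_le1) auto
  then show ?thesis by (smt (verit) zero_le_power2)
next
  case False
  then have "\<bar>z\<bar> powr \<alpha> \<le> \<bar>z\<bar> powr 2" using al1 by (intro powr_mono) auto
  then show ?thesis using False by (simp add: powr_numeral)
qed

text \<open>Each changed coordinate costs \<open>m powr (- \<alpha> - \<beta>)\<close> times
  \<open>1 + (w k)\<^sup>2\<close>. The block has at most \<open>m\<close> coordinates and its
  squares sum to at most \<open>2 * R * m\<close>, whence the factor \<open>1 + 2 * R\<close> and
  the extra power of \<open>m\<close>.\<close>

lemma bm_diff:
  assumes mn: "1 \<le> m" "m < n" "n \<le> 2 * m" "n \<le> K" and R: "R \<ge> 0"
    and S: "(\<Sum>i\<in>{1..n}. (w i)\<^sup>2) \<le> R * real n" and ij: "i \<in> {1..K}" "j \<in> {1..K}"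
  shows "\<bar>bm n w i j - bm m w i j\<bar> \<le>
     \<bar>kb\<bar> * (1 / sqrt (2 * kl)) powr \<alpha> * (1 + 2 * R) * real m powr (1 - \<alpha> - \<beta>)"
proof -
  let ?c = "1 / sqrt (2 * kl)"
  let ?y = "\<lambda>k. ym n w k - ym m w k"
  let ?T = "\<lambda>k. kb * \<bar>?y k\<bar> powr \<alpha> * real k powr (- \<beta>)"
  let ?e = "\<bar>kb\<bar> * ?c powr \<alpha> * real m powr (- \<alpha> - \<beta>)"
  have y0: "?y k = 0" if "k \<in> {1..K}" "k \<notin> {m<..n}" for k
    using that mn unfolding ym_def by auto
  have summand: "?T k \<le> ?e * (1 + (w k)\<^sup>2)" if k: "k \<in> {m<..n}" for k
  proof -
    have kK: "k \<in> {1..K}" and km: "real m \<le> real k" "real m > 0" "real k > 0" using k mn by auto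
    have "?y k = sqrt (g k) * w k" using k kK mn unfolding ym_def by auto
    then have "\<bar>?y k\<bar> \<le> ?c / real k * \<bar>w k\<bar>"
      using mult_right_mono[OF sqrt_g_le[OF kK] abs_ge_zero[of "w k"]] g_pos[OF kK] by (simp add: abs_mult)
    then have "\<bar>?y k\<bar> powr \<alpha> \<le> (?c / real k * \<bar>w k\<bar>) powr \<alpha>"
      using al0 by (intro powr_mono2) auto
    also have "\<dots> = ?c powr \<alpha> * real k powr (- \<alpha>) * \<bar>w k\<bar> powr \<alpha>"
      using kl by (simp add: powr_mult powr_divide powr_minus field_simps)
    also have "\<dots> \<le> ?c powr \<alpha> * real k powr (- \<alpha>) * (1 + (w k)\<^sup>2)"
      by (intro mult_left_mono abs_powr_le) auto
    finally have "?T k \<le> \<bar>kb\<bar> * (?c powr \<alpha> * real k powr (- \<alpha>) * (1 + (w k)\<^sup>2)) * real k powr (- \<beta>)"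
      by (intro mult_right_mono mult_mono) auto
    also have "\<dots> = \<bar>kb\<bar> * ?c powr \<alpha> * (1 + (w k)\<^sup>2) * real k powr (- \<alpha> - \<beta>)"
      using km by (simp add: powr_diff powr_minus field_simps)
    also have "\<dots> \<le> \<bar>kb\<bar> * ?c powr \<alpha> * (1 + (w k)\<^sup>2) * real m powr (- \<alpha> - \<beta>)"
      using km al0 be0 by (intro mult_left_mono powr_mono2') auto
    finally show ?thesis by (simp add: mult_ac)
  qed
  have "\<bar>a (ym n w) i j - a (ym m w) i j\<bar> \<le> (\<Sum>k\<in>{1..K}. ?T k)"
    by (rule holder) (use ij in auto)
  also have "\<dots> = (\<Sum>k\<in>{m<..n}. ?T k)"
    by (rule sum.mono_neutral_right) (use y0 mn in auto)
  also have "\<dots> \<le> (\<Sum>k\<in>{m<..n}. ?e * (1 + (w k)\<^sup>2))" by (rule sum_mono) (rule summand)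
  also have "\<dots> = ?e * (real (n - m) + (\<Sum>k\<in>{m<..n}. (w k)\<^sup>2))"
    by (simp add: sum_distrib_left[symmetric] sum.distrib)
  also have "\<dots> \<le> ?e * ((1 + 2 * R) * real m)"
  proof (rule mult_left_mono)
    have "(\<Sum>k\<in>{m<..n}. (w k)\<^sup>2) \<le> (\<Sum>k\<in>{1..n}. (w k)\<^sup>2)" by (rule sum_mono2) auto
    also have "\<dots> \<le> R * (2 * real m)" using S mult_left_mono[OF _ R, of "real n" "2 * real m"] mn by linarith
    finally show "real (n - m) + (\<Sum>k\<in>{m<..n}. (w k)\<^sup>2) \<le> (1 + 2 * R) * real m"
      using mn by (simp add: algebra_simps)
  qed simp
  also have "\<dots> = \<bar>kb\<bar> * ?c powr \<alpha> * (1 + 2 * R) * real m powr (1 - \<alpha> - \<beta>)"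
  proof -
    have "1 - \<alpha> - \<beta> = 1 + (- \<alpha> - \<beta>)" by simp
    then have "real m powr (1 - \<alpha> - \<beta>) = real m powr 1 * real m powr (- \<alpha> - \<beta>)"
      by (simp only: powr_add)
    then show ?thesis by (simp add: mult_ac)
  qed
  finally have d: "\<bar>a (ym n w) i j - a (ym m w) i j\<bar> \<le>
      \<bar>kb\<bar> * ?c powr \<alpha> * (1 + 2 * R) * real m powr (1 - \<alpha> - \<beta>)" .
  have "\<bar>bm n w i j - bm m w i j\<bar> = \<bar>a (ym n w) i j - a (ym m w) i j\<bar> * rho i j"
    unfolding bm_def using rho_bounds(1)[OF ij] by (simp add: left_diff_distrib[symmetric] abs_mult)
  also have "\<dots> \<le> \<bar>a (ym n w) i j - a (ym m w) i j\<bar> * 1"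
    using rho_bounds(2)[OF ij] by (intro mult_left_mono) auto
  finally show ?thesis using d by simp
qed

text \<open>Entries of size \<open>\<delta>\<close> give operator norm at most
  \<open>\<delta> * n\<close>, by the arithmetic-geometric mean inequality on each product.\<close>

lemma quad_diff_le:
  fixes n :: nat
  assumes "\<And>i j. i \<in> {1..n} \<Longrightarrow> j \<in> {1..n} \<Longrightarrow> \<bar>C i j - D i j\<bar> \<le> \<delta>"
  shows "quad_on {1..n} C v \<le> quad_on {1..n} D v + \<delta> * real n * (\<Sum>i\<in>{1..n}. (v i)\<^sup>2)"
proof (cases "n = 0")
  case False
  have d0: "\<delta> \<ge> 0" using assms[of 1 1] False by (simp add: order_trans[OF abs_ge_zero])
  have "quad_on {1..n} C v - quad_on {1..n} D v = (\<Sum>i\<in>{1..n}. \<Sum>j\<in>{1..n}. v i * (C i j - D i j) * v j)"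
    unfolding quad_on_def by (simp add: sum_subtractf algebra_simps)
  also have "\<dots> \<le> (\<Sum>i\<in>{1..n}. \<Sum>j\<in>{1..n}. \<delta> * (\<bar>v i\<bar> * \<bar>v j\<bar>))"
  proof (intro sum_mono)
    fix i j assume ij: "i \<in> {1..n}" "j \<in> {1..n}"
    have "v i * (C i j - D i j) * v j \<le> \<bar>v i * (C i j - D i j) * v j\<bar>" by simp
    also have "\<dots> = \<bar>C i j - D i j\<bar> * (\<bar>v i\<bar> * \<bar>v j\<bar>)" by (simp add: abs_mult)
    also have "\<dots> \<le> \<delta> * (\<bar>v i\<bar> * \<bar>v j\<bar>)" using assms[OF ij] by (intro mult_right_mono) auto
    finally show "v i * (C i j - D i j) * v j \<le> \<delta> * (\<bar>v i\<bar> * \<bar>v j\<bar>)" .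
  qed
  also have "\<dots> \<le> (\<Sum>i\<in>{1..n}. \<Sum>j\<in>{1..n}. \<delta> * (((v i)\<^sup>2 + (v j)\<^sup>2) / 2))"
  proof (intro sum_mono mult_left_mono d0)
    fix i j show "\<bar>v i\<bar> * \<bar>v j\<bar> \<le> ((v i)\<^sup>2 + (v j)\<^sup>2) / 2"
      using sum_squares_bound[of "\<bar>v i\<bar>" "\<bar>v j\<bar>"] by simp
  qed
  also have "\<dots> = \<delta> * real n * (\<Sum>i\<in>{1..n}. (v i)\<^sup>2)"
    by (simp add: sum_distrib_left[symmetric] sum.distrib add_divide_distrib sum_divide_distrib[symmetric])
  finally show ?thesis by simp
qed (simp add: quad_on_def)

text \<open>The relative perturbation, of order \<open>\<delta> * n\<close>, enters the exponent
  \<open>n\<close> times over: through the power \<open>n / 2\<close> in the normaliser and through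
  \<open>|w|^2 \<le> R n\<close>. With \<open>\<delta>\<close> of order
  \<open>m powr (1 - \<alpha> - \<beta>)\<close>, the product with \<open>n^2\<close> has exponent
  \<open>3 - \<alpha> - \<beta>\<close>.\<close>

lemma Qd_step:
  assumes mn: "1 \<le> m" "m < n" "n \<le> 2 * m" "n \<le> K" and R: "R \<ge> 0"
    and S: "(\<Sum>i\<in>{1..n}. (w i)\<^sup>2) \<le> R * real n"
  defines "D \<equiv> 2 * (\<bar>kb\<bar> * (1 / sqrt (2 * kl)) powr \<alpha> * (1 + 2 * R)) * (1 + R / L0) / L0"
  shows "Qd {1..n} w (mat_inv_on {1..n} (bm n w)) \<le>
    exp (D * real m powr (3 - \<alpha> - \<beta>)) * Qd {1..n} w (mat_inv_on {1..n} (bm m w))"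
proof -
  define d where "d = \<bar>kb\<bar> * (1 / sqrt (2 * kl)) powr \<alpha> * (1 + 2 * R)"
  define \<delta> where "\<delta> = d * real m powr (1 - \<alpha> - \<beta>)"
  have d0: "d \<ge> 0" unfolding d_def using R by simp
  have \<delta>0: "\<delta> \<ge> 0" unfolding \<delta>_def using d0 by simp
  \<comment> \<open>Ellipticity turns the additive error \<open>\<delta> * n\<close> into the
    multiplicative factor \<open>k\<close> required by \<open>Qd_compare\<close>.\<close>
  define k where "k = 1 + \<delta> * real n / L0"
  have k1: "k \<ge> 1" unfolding k_def using \<delta>0 L0 by simp
  have diff: "\<bar>bm n w i j - bm m w i j\<bar> \<le> \<delta>" if "i \<in> {1..n}" "j \<in> {1..n}" for i j
    unfolding \<delta>_def d_def using bm_diff[OF mn R S, of i j] that mn by auto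
  have up: "\<delta> * real n * (\<Sum>i\<in>{1..n}. (v i)\<^sup>2) \<le> (k - 1) * quad_on {1..n} (bm l w) v" for v l
  proof -
    have "L0 * (\<Sum>i\<in>{1..n}. (v i)\<^sup>2) \<le> quad_on {1..n} (bm l w) v"
      using pd_bm'[OF mn(4)] unfolding pd_def by blast
    then have "(k - 1) * (L0 * (\<Sum>i\<in>{1..n}. (v i)\<^sup>2)) \<le> (k - 1) * quad_on {1..n} (bm l w) v"
      using k1 by (intro mult_left_mono) auto
    then show ?thesis unfolding k_def using L0 by simp
  qed
  have le1: "quad_on {1..n} (bm n w) v \<le> k * quad_on {1..n} (bm m w) v" for v
    using quad_diff_le[of n "bm n w" "bm m w" \<delta> v] diff up[of v m] by (simp add: algebra_simps)
  have le2: "quad_on {1..n} (bm m w) v \<le> k * quad_on {1..n} (bm n w) v" for v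
    using quad_diff_le[of n "bm m w" "bm n w" \<delta> v] diff up[of v n]
    by (simp add: algebra_simps abs_minus_commute)
  let ?q = "Qd {1..n} w (mat_inv_on {1..n} (bm m w))"
  let ?S = "\<Sum>i\<in>{1..n}. (w i)\<^sup>2"
  have q0: "?q \<ge> 0" by (rule Qd_nonneg[OF pd_bm'[OF mn(4)] L0 L1_pos])
  have "Qd {1..n} w (mat_inv_on {1..n} (bm n w)) \<le>
      k powr (n / 2) * exp ((k - 1) * ?S / (2 * L0)) * ?q"
    by (rule Qd_compare[OF pd_bm'[OF mn(4)] pd_bm'[OF mn(4)] L0 L1_pos k1 le1 le2])
  also have "\<dots> \<le> exp (D * real m powr (3 - \<alpha> - \<beta>)) * ?q"
  proof (rule mult_right_mono[OF _ q0])
    have "k powr (n / 2) = exp (real n / 2 * ln k)" using k1 by (simp add: powr_def)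
    also have "\<dots> \<le> exp (real n / 2 * (k - 1))"
      using ln_le_minus_one[of k] k1 by (simp add: mult_left_mono)
    finally have 1: "k powr (n / 2) \<le> exp (real n / 2 * (k - 1))" .
    have "(k - 1) * ?S / (2 * L0) \<le> (k - 1) * (R * real n) / (2 * L0)"
      using k1 L0 by (intro divide_right_mono mult_left_mono S) auto
    then have 2: "exp ((k - 1) * ?S / (2 * L0)) \<le> exp ((k - 1) * (R * real n) / (2 * L0))" by simp
    have "k powr (n / 2) * exp ((k - 1) * ?S / (2 * L0)) \<le>
        exp (real n / 2 * (k - 1)) * exp ((k - 1) * (R * real n) / (2 * L0))"
      by (intro mult_mono 1 2) auto
    \<comment> \<open>Insert \<open>k - 1 = \<delta> * n / L0\<close>. The bound
      \<open>n \<le> 2 * m\<close> then supplies a factor 4, which turns the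
      \<open>1 / (2 * L0)\<close> here into the \<open>2 / L0\<close> of \<open>D\<close>.\<close>
    also have "\<dots> = exp (\<delta> * (real n)\<^sup>2 * ((1 + R / L0) / (2 * L0)))"
      unfolding k_def exp_add[symmetric] using L0 by (simp add: power2_eq_square field_simps)
    also have "\<dots> \<le> exp (\<delta> * (2 * real m)\<^sup>2 * ((1 + R / L0) / (2 * L0)))"
    proof -
      have "(real n)\<^sup>2 \<le> (2 * real m)\<^sup>2" using mn by (intro power_mono) auto
      then show ?thesis using \<delta>0 R L0 by (simp only: exp_le_cancel_iff) (intro mult_right_mono mult_left_mono, auto)
    qed
    also have "\<delta> * (2 * real m)\<^sup>2 * ((1 + R / L0) / (2 * L0)) = D * real m powr (3 - \<alpha> - \<beta>)"
    proof -
      have "real m powr (3 - \<alpha> - \<beta>) = real m powr (1 - \<alpha> - \<beta>) * (real m)\<^sup>2"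
      proof -
        have "3 - \<alpha> - \<beta> = (1 - \<alpha> - \<beta>) + 2" by simp
        moreover have "real m powr 2 = (real m)\<^sup>2" using mn by (intro powr_numeral) simp
        ultimately show ?thesis by (simp only: powr_add)
      qed
      then show ?thesis unfolding D_def \<delta>_def d_def[symmetric] using L0
        by (simp add: field_simps)
    qed
    finally show "k powr (n / 2) * exp ((k - 1) * ?S / (2 * L0)) \<le> exp (D * real m powr (3 - \<alpha> - \<beta>))" .
  qed
  finally show ?thesis .
qed

end

subsection \<open>Dyadic iteration\<close>

lemma abspow_nonneg: "abspow z q \<ge> 0"
  unfolding abspow_def by simp

lemma measurable_abspow [measurable]: "(\<lambda>z. abspow z q) \<in> borel_measurable borel"
  unfolding abspow_def by measurable

text \<open>With \<open>u = c * z\<^sup>2 / p\<close> this is \<open>u \<le> exp u\<close> raised to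
  the power \<open>p\<close>. The summand \<open>1\<close> serves \<open>p = 0\<close>, where
  \<open>abspow\<close> is \<open>1\<close> but \<open>(p / c) powr p\<close> is
  \<open>0\<close>.\<close>

lemma abspow_le_exp:
  assumes "p \<ge> 0" "c > 0"
  shows "abspow z (2 * p) \<le> (1 + (p / c) powr p) * exp (c * z\<^sup>2)"
proof (cases "p = 0 \<or> z = 0")
  case True
  then have "abspow z (2 * p) \<le> 1" unfolding abspow_def by auto
  also have "1 \<le> (1 + (p / c) powr p) * exp (c * z\<^sup>2)"
    using assms mult_mono[of 1 "1 + (p / c) powr p" 1 "exp (c * z\<^sup>2)"] by simp
  finally show ?thesis .
next
  case False
  then have p: "p > 0" and z: "z\<^sup>2 > 0" using assms by auto
  let ?u = "c * z\<^sup>2 / p"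
  have u: "0 \<le> ?u" "?u \<le> exp ?u"
    using p assms exp_ge_add_one_self[of ?u] by (simp, linarith)
  have "abspow z (2 * p) = (z\<^sup>2) powr p"
    using False p unfolding abspow_def by (simp add: powr_powr[symmetric] powr_numeral)
  also have "\<dots> = (p / c) powr p * ?u powr p"
    using p assms z by (simp add: powr_mult[symmetric])
  also have "\<dots> \<le> (p / c) powr p * exp ?u powr p"
    using p by (intro mult_left_mono powr_mono2 u) auto
  also have "exp ?u powr p = exp (c * z\<^sup>2)" using p by (simp add: powr_def)
  also have "(p / c) powr p * exp (c * z\<^sup>2) \<le> (1 + (p / c) powr p) * exp (c * z\<^sup>2)" by simp
  finally show ?thesis .
qed

text \<open>A discrete Gronwall argument over the scales \<open>2 ^ k * j\<close>, with both kinds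
  of error summing to at most \<open>T / (1 - q)\<close>. As \<open>K\<close> need not be such a
  scale, a step may end anywhere in its block.\<close>

lemma dyadic_chain:
  fixes F :: "nat \<Rightarrow> ennreal" and T q :: real
  assumes T: "T \<ge> 0" and q: "0 \<le> q" "q < 1" and j: "1 \<le> j" "j \<le> K"
    and step: "\<And>k n. 2 ^ k * j < n \<Longrightarrow> n \<le> 2 * (2 ^ k * j) \<Longrightarrow> n \<le> K \<Longrightarrow>
      F n \<le> ennreal (exp (T * q ^ k)) * F (2 ^ k * j) + ennreal (T * q ^ k)"
  shows "F K \<le> ennreal (exp (T / (1 - q)) * (1 + T / (1 - q))) * (F j + 1)"
proof -
  define s where "s k = (\<Sum>i<k. q ^ i)" for k :: nat
  have s0: "s k \<ge> 0" for k unfolding s_def using q by (simp add: sum_nonneg)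
  have ss: "s (Suc k) = s k + q ^ k" for k unfolding s_def by simp
  have claim: "F n \<le> ennreal (exp (T * s k)) * (F j + ennreal (T * s k))"
    if "j \<le> n" "n \<le> 2 ^ k * j" "n \<le> K" for n k
    using that
  proof (induction k arbitrary: n)
    case 0
    then show ?case by (simp add: s_def)
  next
    case (Suc k)
    have T0: "T * s k \<ge> 0" "T * q ^ k \<ge> 0" using T s0 q by auto
    have Ts: "T * s (Suc k) = T * s k + T * q ^ k" by (simp add: ss distrib_left)
    show ?case
    proof (cases "n \<le> 2 ^ k * j")
      case True
      then have "F n \<le> ennreal (exp (T * s k)) * (F j + ennreal (T * s k))"
        using Suc by simp
      also have "\<dots> \<le> ennreal (exp (T * s (Suc k))) * (F j + ennreal (T * s (Suc k)))"
        unfolding Ts using T0 by (intro mult_mono add_mono ennreal_leI) auto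
      finally show ?thesis .
    next
      case False
      let ?m = "2 ^ k * j"
      have m: "?m < n" "n \<le> 2 * ?m" "n \<le> K" using False Suc.prems by auto
      have "j \<le> ?m" by simp
      then have Fm: "F ?m \<le> ennreal (exp (T * s k)) * (F j + ennreal (T * s k))"
        using Suc.IH[of ?m] m by simp
      have "F n \<le> ennreal (exp (T * q ^ k)) * F ?m + ennreal (T * q ^ k)" by (rule step[OF m])
      also have "\<dots> \<le> ennreal (exp (T * q ^ k)) * (ennreal (exp (T * s k)) * (F j + ennreal (T * s k)))
          + ennreal (exp (T * s (Suc k))) * ennreal (T * q ^ k)"
      proof (intro add_mono mult_left_mono Fm)
        \<comment> \<open>The new additive error is enlarged by an exponential factor at least one,
          so that it joins the sum already inside the common factor.\<close>
        have "1 * (T * q ^ k) \<le> exp (T * s (Suc k)) * (T * q ^ k)"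
          unfolding Ts using T0 by (intro mult_right_mono) auto
        then show "ennreal (T * q ^ k) \<le> ennreal (exp (T * s (Suc k))) * ennreal (T * q ^ k)"
          using T0 by (simp add: ennreal_mult[symmetric] ennreal_leI)
      qed simp
      also have "ennreal (exp (T * q ^ k)) * (ennreal (exp (T * s k)) * (F j + ennreal (T * s k))) =
          ennreal (exp (T * s (Suc k))) * (F j + ennreal (T * s k))"
        unfolding Ts mult.assoc[symmetric] by (simp add: ennreal_mult[symmetric] exp_add mult.commute)
      also have "\<dots> + ennreal (exp (T * s (Suc k))) * ennreal (T * q ^ k) =
          ennreal (exp (T * s (Suc k))) * (F j + ennreal (T * s (Suc k)))"
        unfolding Ts using T0 by (simp add: distrib_left add.assoc)
      finally show ?thesis .
    qed
  qed
  \<comment> \<open>\<open>K\<close> doublings suffice because \<open>K < 2 ^ K\<close>; their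
    number leaves no trace, since the geometric sum is bounded.\<close>
  have "K \<le> 2 ^ K * j" using mult_le_mono[of K "2 ^ K" 1 j] j less_exp[of K] by simp
  then have "F K \<le> ennreal (exp (T * s K)) * (F j + ennreal (T * s K))"
    using claim[of K K] j by simp
  also have "\<dots> \<le> ennreal (exp (T / (1 - q))) * (F j + ennreal (T / (1 - q)))"
  proof -
    have "s K \<le> 1 / (1 - q)"
      unfolding s_def using q sum_gp_strict[of q K] by (simp add: divide_right_mono)
    then have "T * s K \<le> T / (1 - q)" using T mult_left_mono[of "s K" "1 / (1 - q)" T] by simp
    then show ?thesis by (intro mult_mono add_mono ennreal_leI) auto
  qed
  also have "\<dots> \<le> ennreal (exp (T / (1 - q))) * (ennreal (1 + T / (1 - q)) * (F j + 1))"
  proof (intro mult_left_mono)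
    have U: "T / (1 - q) \<ge> 0" using T q by simp
    have "F j + ennreal (T / (1 - q)) \<le> (F j + 1) + ennreal (T / (1 - q)) * (F j + 1)"
      by (intro add_mono) (auto simp: distrib_left)
    also have "\<dots> = ennreal (1 + T / (1 - q)) * (F j + 1)"
      using U by (simp add: distrib_right)
    finally show "F j + ennreal (T / (1 - q)) \<le> ennreal (1 + T / (1 - q)) * (F j + 1)" .
  qed simp
  also have "\<dots> = ennreal (exp (T / (1 - q)) * (1 + T / (1 - q))) * (F j + 1)"
    using T q by (simp add: ennreal_mult mult.assoc)
  finally show ?thesis .
qed

text \<open>The radius is chosen so that outside \<open>|w|\<^sup>2 \<le> R n\<close> the Gaussian tail, which decays like
  \<open>exp (- R n / (8 L1))\<close>, beats the factor \<open>(2 L1 / L0)\<^bsup>n/2\<^esup>\<close> lost by comparing the variable covariance with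
  constant ones, leaving \<open>exp (- n)\<close>.\<close>

definition trunc_radius :: "real \<Rightarrow> real \<Rightarrow> real" where
  "trunc_radius L0 L1 = 8 * L1 * (1 + ln (2 * L1 / L0) / 2)"

text \<open>The constant \<open>D\<close> of \<open>Qd_step\<close>, named outside the locale so
  that the final constant can be chosen before \<open>K\<close>.\<close>

definition step_const :: "real \<Rightarrow> real \<Rightarrow> real \<Rightarrow> real \<Rightarrow> real \<Rightarrow> real" where
  "step_const L0 kl \<alpha> kb R =
     2 * (\<bar>kb\<bar> * (1 / sqrt (2 * kl)) powr \<alpha> * (1 + 2 * R)) * (1 + R / L0) / L0"

section \<open>Moments across dimensions\<close>

context ou_setting
begin

text \<open>Interpolates between the two integrals of (a): \<open>n = K\<close> is the left one,
  \<open>n = j\<close> the right one.\<close>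

definition moment :: "real \<Rightarrow> nat \<Rightarrow> nat \<Rightarrow> ennreal" where
  "moment p j n = (\<integral>\<^sup>+w. ennreal (abspow (w j) (2 * p) *
     Qd {1..n} w (mat_inv_on {1..n} (bm n w))) \<partial>leb {1..n})"

lemma trunc_radius_nonneg: "trunc_radius L0 L1 \<ge> 0"
proof -
  have "2 * L1 / L0 \<ge> 1" using L0 L01 by (simp add: field_simps)
  then show ?thesis using L1_pos unfolding trunc_radius_def by (intro mult_nonneg_nonneg) auto
qed

text \<open>In the ball of squared radius \<open>R * n\<close> the density is compared by
  \<open>Qd_step\<close> and then marginalised to dimension \<open>m\<close>; outside it the
  Gaussian bound gives the additive error.\<close>

lemma moment_step:
  assumes mn: "1 \<le> j" "j \<le> m" "m < n" "n \<le> 2 * m" "n \<le> K" and p: "p \<ge> 0"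
    and c: "\<And>z. abspow z (2 * p) \<le> c * exp (1 / (8 * L1) * z\<^sup>2)"
  shows "moment p j n \<le>
     ennreal (exp (step_const L0 kl \<alpha> kb (trunc_radius L0 L1) * real m powr (3 - \<alpha> - \<beta>))) * moment p j m
     + ennreal (c * exp (- real n))"
proof -
  define R where "R = trunc_radius L0 L1"
  define E where "E = exp (step_const L0 kl \<alpha> kb R * real m powr (3 - \<alpha> - \<beta>))"
  define B where "B = c * ((2 * pi * L0) powr (- real n / 2) * exp (- R * real n / (8 * L1)))"
  let ?f = "\<lambda>w. abspow (w j) (2 * p)"
  let ?S = "\<lambda>w. \<Sum>i\<in>{1..n}. (w i)\<^sup>2"
  let ?Q = "\<lambda>l w. Qd {1..n} w (mat_inv_on {1..n} (bm l w))"
  have R0: "R \<ge> 0" unfolding R_def by (rule trunc_radius_nonneg)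
  have c0: "c \<ge> 0" using c[of 0] abspow_nonneg[of 0 "2 * p"] by simp
  have Q0: "\<forall>l w. ?Q l w \<ge> 0" by (intro allI Qd_nonneg[OF pd_bm'[OF mn(5)] L0 L1_pos])
  have B0: "B \<ge> 0" unfolding B_def using c0 by simp
  \<comment> \<open>Both regimes are covered by the sum of the two bounds for every
    \<open>w\<close>, so no integral over a truncated region arises and exact marginalisation
    applies.\<close>
  have pt: "?f w * ?Q n w \<le> E * (?f w * ?Q m w) + B * exp (- (?S w / (2 * (2 * L1))))" for w
  proof (cases "?S w \<le> R * real n")
    case True
    have "?Q n w \<le> E * ?Q m w"
      unfolding E_def step_const_def by (rule Qd_step[OF _ mn(3-5) R0 True]) (use mn in simp)
    then have "?f w * ?Q n w \<le> ?f w * (E * ?Q m w)" using abspow_nonneg by (intro mult_left_mono) auto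
    then show ?thesis using B0 by (simp add: mult_ac add_increasing2)
  next
    case False
    have wj: "(w j)\<^sup>2 \<le> ?S w" using mn by (intro member_le_sum) auto
    have "?f w * ?Q n w \<le> (c * exp (1 / (8 * L1) * (w j)\<^sup>2)) *
        ((2 * pi * L0) powr (- real n / 2) * exp (- (?S w / (2 * L1))))"
      by (intro mult_mono c Qd_le_gauss[OF pd_bm'[OF mn(5)] L0 L1_pos] Q0[rule_format]) (use c0 in auto)
    also have "\<dots> = c * (2 * pi * L0) powr (- real n / 2) * exp (1 / (8 * L1) * (w j)\<^sup>2 - ?S w / (2 * L1))"
      by (simp add: exp_diff exp_minus field_simps)
    also have "\<dots> \<le> c * (2 * pi * L0) powr (- real n / 2) *
        exp (- R * real n / (8 * L1) - ?S w / (2 * (2 * L1)))"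
    proof -
      \<comment> \<open>In units of \<open>1 / (8 * L1)\<close> the Gaussian decay is four times the
        squared norm: one part pays for the moment, one yields \<open>R * n\<close> outside the
        ball, two remain for integration.\<close>
      have "(w j)\<^sup>2 - 4 * ?S w \<le> - R * real n - 2 * ?S w"
        using wj False by linarith
      then have "((w j)\<^sup>2 - 4 * ?S w) / (8 * L1) \<le> (- R * real n - 2 * ?S w) / (8 * L1)"
        using L1_pos by (intro divide_right_mono) auto
      then have "1 / (8 * L1) * (w j)\<^sup>2 - ?S w / (2 * L1) \<le> - R * real n / (8 * L1) - ?S w / (2 * (2 * L1))"
        using L1_pos by (simp add: diff_divide_distrib)
      then show ?thesis using c0 by (intro mult_left_mono) auto
    qed
    also have "\<dots> = B * exp (- (?S w / (2 * (2 * L1))))"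
      unfolding B_def by (simp add: exp_diff exp_minus field_simps)
    finally have 1: "?f w * ?Q n w \<le> B * exp (- (?S w / (2 * (2 * L1))))" .
    have "E * (?f w * ?Q m w) \<ge> 0"
      unfolding E_def using Q0[rule_format, of w m] abspow_nonneg[of "w j" "2 * p"] by simp
    then show ?thesis using 1 by linarith
  qed
  have jn: "j \<in> {1..n}" using mn by auto
  have Qm [measurable]: "(\<lambda>w. ?Q l w) \<in> borel_measurable (leb {1..n})" if "l \<le> n" for l
    by (rule measurable_Qd_bm[OF mn(5) that]) measurable
  have fm [measurable]: "?f \<in> borel_measurable (leb {1..n})"
    using jn by measurable
  have Sm [measurable]: "?S \<in> borel_measurable (leb {1..n})" by measurable
  have "moment p j n \<le> (\<integral>\<^sup>+w. ennreal E * ennreal (?f w * ?Q m w) +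
      ennreal B * ennreal (exp (- (?S w / (2 * (2 * L1))))) \<partial>leb {1..n})"
    unfolding moment_def
  proof (rule nn_integral_mono)
    fix w
    have "ennreal (?f w * ?Q n w) \<le> ennreal (E * (?f w * ?Q m w) + B * exp (- (?S w / (2 * (2 * L1)))))"
      by (rule ennreal_leI[OF pt])
    also have "\<dots> = ennreal E * ennreal (?f w * ?Q m w) + ennreal B * ennreal (exp (- (?S w / (2 * (2 * L1)))))"
      using B0 Q0[rule_format, of w m] abspow_nonneg[of "w j" "2 * p"]
      by (simp add: E_def ennreal_mult)
    finally show "ennreal (?f w * ?Q n w) \<le> ennreal E * ennreal (?f w * ?Q m w) +
      ennreal B * ennreal (exp (- (?S w / (2 * (2 * L1)))))" .
  qed
  also have "\<dots> = ennreal E * (\<integral>\<^sup>+w. ennreal (?f w * ?Q m w) \<partial>leb {1..n}) +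
      ennreal B * (\<integral>\<^sup>+w. ennreal (exp (- (?S w / (2 * (2 * L1))))) \<partial>leb {1..n})"
    using Qm[of m] mn by (subst nn_integral_add) (auto simp: nn_integral_cmult)
  also have "(\<integral>\<^sup>+w. ennreal (?f w * ?Q m w) \<partial>leb {1..n}) = moment p j m"
  proof -
    have "(\<integral>\<^sup>+w. ennreal (?f w) * ennreal (?Q m w) \<partial>leb {1..n}) =
        (\<integral>\<^sup>+w. ennreal (?f w) * ennreal (Qd {1..m} w (mat_inv_on {1..m} (bm m w))) \<partial>leb {1..m})"
      by (rule marginal_bm[where f="\<lambda>z. ennreal (abspow z (2 * p))"]) (use mn in auto)
    then show ?thesis unfolding moment_def by (simp add: ennreal_mult' abspow_nonneg)
  qed
  also have "(\<integral>\<^sup>+w. ennreal (exp (- (?S w / (2 * (2 * L1))))) \<partial>leb {1..n}) =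
      ennreal ((2 * pi * (2 * L1)) powr (real n / 2))"
    using nn_integral_gauss_iso[of "2 * L1" "{1..n}"] L1_pos by simp
  also have "ennreal B * \<dots> = ennreal (c * exp (- real n))"
  proof -
    let ?r = "2 * L1 / L0"
    have r: "?r > 0" using L0 L1_pos by simp
    have Rr: "R / (8 * L1) = 1 + ln ?r / 2" unfolding R_def trunc_radius_def using L1_pos by simp
    have "- R * real n / (8 * L1) = - real n * (R / (8 * L1))" by simp
    also have "\<dots> = - real n - real n / 2 * ln ?r" unfolding Rr by (simp add: distrib_left)
    finally have "- R * real n / (8 * L1) = - real n - real n / 2 * ln ?r" .
    then have 1: "exp (- R * real n / (8 * L1)) = exp (- real n) / ?r powr (real n / 2)"
      using r L0 L1_pos by (simp add: powr_def exp_diff)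
    have 2: "(2 * pi * (2 * L1)) powr (real n / 2) = (2 * pi * L0) powr (real n / 2) * ?r powr (real n / 2)"
      using L0 L1_pos by (simp add: powr_mult[symmetric])
    have "B * (2 * pi * (2 * L1)) powr (real n / 2) = c * exp (- real n)"
      unfolding B_def 1 2 using L0 L1_pos r by (simp add: powr_minus field_simps)
    then show ?thesis using B0 by (simp add: ennreal_mult[symmetric])
  qed
  finally show ?thesis unfolding E_def R_def .
qed

text \<open>Since \<open>j \<ge> 1\<close>, the scale \<open>2 ^ k * j\<close> is at least
  \<open>2 ^ k\<close>, so both errors of \<open>moment_step\<close> decay with ratio
  \<open>2 powr - e\<close>, uniformly in \<open>j\<close> and \<open>K\<close>.\<close>

lemma moment_bound:
  assumes j: "1 \<le> j" "j \<le> K" and p: "p \<ge> 0"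
    and c: "\<And>z. abspow z (2 * p) \<le> c * exp (1 / (8 * L1) * z\<^sup>2)"
    and e: "0 < e" "e \<le> 1" "e \<le> \<alpha> + \<beta> - 3"
    and T: "step_const L0 kl \<alpha> kb (trunc_radius L0 L1) \<le> T" "c \<le> T" "0 \<le> T"
  shows "moment p j K \<le> ennreal (exp (T / (1 - 2 powr - e)) * (1 + T / (1 - 2 powr - e))) * (moment p j j + 1)"
proof (rule dyadic_chain[OF T(3) _ _ j])
  show "2 powr - e < 1" using e by (simp add: powr_less_one)
  fix k n :: nat
  let ?m = "2 ^ k * j"
  assume mn: "?m < n" "n \<le> 2 * ?m" "n \<le> K"
  have m1: "1 \<le> ?m" "j \<le> ?m" using mult_le_mono[of 1 "2 ^ k" 1 j] j by auto
  have mr: "(2::real) ^ k \<le> real ?m" using j by simp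
  have qk: "(2 powr - e) ^ k = (2 ^ k) powr - e"
    by (simp add: powr_power mult.commute powr_realpow[symmetric] powr_powr)
  have A: "real ?m powr - e \<le> (2 powr - e) ^ k"
    unfolding qk using mr e by (intro powr_mono2') auto
  have "real ?m powr (3 - \<alpha> - \<beta>) \<le> real ?m powr - e"
  proof (rule powr_mono)
    show "1 \<le> real ?m" using m1(1) by linarith
  qed (use e in linarith)
  then have "real ?m powr (3 - \<alpha> - \<beta>) \<le> (2 powr - e) ^ k" using A by linarith
  then have E: "step_const L0 kl \<alpha> kb (trunc_radius L0 L1) * real ?m powr (3 - \<alpha> - \<beta>) \<le> T * (2 powr - e) ^ k"
    using T by (intro mult_mono) auto
  have c0: "c \<ge> 0" using c[of 0] abspow_nonneg[of 0 "2 * p"] by simp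
  \<comment> \<open>Here \<open>e \<le> 1\<close> enters: the tail is bounded by
    \<open>1 / n\<close>, hence by \<open>n powr - e\<close>.\<close>
  have "exp (- real n) \<le> (2 powr - e) ^ k"
  proof -
    have n: "real ?m \<le> real n" "1 \<le> real ?m" using mn m1 by linarith+
    have "real n \<le> exp (real n)" using exp_ge_add_one_self[of "real n"] by linarith
    then have "exp (- real n) \<le> real n powr - 1"
      using n by (simp add: exp_minus powr_minus divide_simps)
    also have "\<dots> \<le> real n powr - e" using n e by (intro powr_mono) auto
    also have "\<dots> \<le> real ?m powr - e" using n e by (intro powr_mono2') auto
    finally show ?thesis using A by linarith
  qed
  then have B: "c * exp (- real n) \<le> T * (2 powr - e) ^ k" using T c0 by (intro mult_mono) auto
  have "moment p j n \<le>
     ennreal (exp (step_const L0 kl \<alpha> kb (trunc_radius L0 L1) * real ?m powr (3 - \<alpha> - \<beta>))) * moment p j ?m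
     + ennreal (c * exp (- real n))"
    by (rule moment_step[OF j(1) m1(2) mn p c])
  also have "\<dots> \<le> ennreal (exp (T * (2 powr - e) ^ k)) * moment p j ?m + ennreal (T * (2 powr - e) ^ k)"
    using E B by (intro add_mono mult_right_mono ennreal_leI) auto
  finally show "moment p j n \<le> ennreal (exp (T * (2 powr - e) ^ k)) * moment p j ?m + ennreal (T * (2 powr - e) ^ k)" .
qed simp

text \<open>Integrating \<open>Qd_le_gauss\<close> in one dimension; this starts the chain for
  (b).\<close>

lemma moment_one:
  assumes "1 \<le> K"
  shows "moment 0 1 1 \<le> ennreal ((L1 / L0) powr (1 / 2))"
proof -
  let ?S = "\<lambda>w. \<Sum>i\<in>{1..1::nat}. (w i)\<^sup>2"
  have Sm [measurable]: "?S \<in> borel_measurable (leb {1..1})" by measurable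
  let ?k = "(2 * pi * L0) powr (- real 1 / 2)"
  have "moment 0 1 1 \<le> (\<integral>\<^sup>+w. ennreal ?k * ennreal (exp (- (?S w / (2 * L1)))) \<partial>leb {1..1})"
    unfolding moment_def
  proof (rule nn_integral_mono)
    fix w
    have "ennreal (abspow (w 1) (2 * 0) * Qd {1..1} w (mat_inv_on {1..1} (bm 1 w))) \<le>
        ennreal (?k * exp (- (?S w / (2 * L1))))"
      using Qd_le_gauss[OF pd_bm'[OF assms] L0 L1_pos, of w 1 w]
      by (intro ennreal_leI) (simp add: abspow_def)
    then show "ennreal (abspow (w 1) (2 * 0) * Qd {1..1} w (mat_inv_on {1..1} (bm 1 w))) \<le>
        ennreal ?k * ennreal (exp (- (?S w / (2 * L1))))" by (simp add: ennreal_mult)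
  qed
  also have "\<dots> = ennreal ?k * ennreal ((2 * pi * L1) powr (1 / 2))"
    using nn_integral_gauss_iso[of L1 "{1..1}"] L1_pos by (subst nn_integral_cmult) auto
  also have "\<dots> = ennreal ((L1 / L0) powr (1 / 2))"
  proof -
    have "?k * (2 * pi * L1) powr (1 / 2) = (L1 / L0) powr (1 / 2)"
      using L0 L1_pos by (simp add: powr_minus powr_mult powr_divide field_simps)
    then show ?thesis by (simp add: ennreal_mult[symmetric])
  qed
  finally show ?thesis .
qed

subsection \<open>Identification with the matrices of the statement\<close>

lemma yof_eq: "yof {1..K} lam t x w = ym K w"
  unfolding yof_def ym_def by (auto simp: fun_eq_iff restrict_def)

lemma bm_aT: "bm m w = (\<lambda>i j. sqrt (Gd lam t i) * aT lam a (ym m w) t i j * sqrt (Gd lam t j))"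
  unfolding bm_def rho_def aT_def by (simp add: fun_eq_iff)

lemma Atm_eq:
  assumes "m \<le> K"
  shows "Atm K lam a x m (yof {1..m} lam t x w) t = mat_inv_on {1..m} (bm m w)"
proof -
  have "pim K lam t x m (yof {1..m} lam t x w) = ym m w"
    unfolding pim_def yof_def ym_def using assms by (auto simp: fun_eq_iff restrict_def)
  then show ?thesis unfolding Atm_def bm_aT by simp
qed

lemma sqrt_gG: "i \<in> {1..K} \<Longrightarrow> sqrt (g i) * sqrt (Gd lam t i) = 1"
  using g_pos[of i] unfolding Gd_def by (simp add: real_sqrt_divide)

text \<open>\<open>bm\<close> is \<open>aT\<close> scaled by the square roots of \<open>G\<close> on
  both sides, so its inverse is \<open>AT\<close> scaled by the reciprocal factors, which are those
  in \<open>AtT\<close>.\<close>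

lemma AtT_eq:
  assumes "i \<in> {1..K}" "j \<in> {1..K}"
  shows "AtT K lam a (ym K w) t i j = mat_inv_on {1..K} (bm K w) i j"
proof -
  let ?I = "{1..K}" and ?N = "aT lam a (ym K w) t" and ?b = "bm K w"
  let ?G = "\<lambda>i. sqrt (Gd lam t i)" and ?g = "\<lambda>i. sqrt (g i)"
  have b: "?b i j = ?G i * ?N i j * ?G j" for i j unfolding bm_aT by simp
  have invb: "is_inv ?I ?b (mat_inv_on ?I ?b)" by (rule is_inv_mat_inv_on[OF pd_bm L0])
  have "is_inv ?I ?N (\<lambda>i j. ?G i * mat_inv_on ?I ?b i j * ?G j)"
    unfolding is_inv_def
  proof (intro ballI)
    fix i j assume ij: "i \<in> ?I" "j \<in> ?I"
    have "?N i k * (?G k * mat_inv_on ?I ?b k j * ?G j) = ?g i * (?b i k * mat_inv_on ?I ?b k j) * ?G j" for k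
    proof -
      have "?g i * (?b i k * mat_inv_on ?I ?b k j) * ?G j =
          (?g i * ?G i) * (?N i k * (?G k * mat_inv_on ?I ?b k j * ?G j))"
        unfolding b by (simp only: mult_ac)
      then show ?thesis unfolding sqrt_gG[OF ij(1)] by (simp only: mult_1)
    qed
    then have "(\<Sum>k\<in>?I. ?N i k * (?G k * mat_inv_on ?I ?b k j * ?G j)) =
        ?g i * (\<Sum>k\<in>?I. ?b i k * mat_inv_on ?I ?b k j) * ?G j"
      unfolding sum_distrib_left sum_distrib_right by (intro sum.cong refl)
    also have "\<dots> = (if i = j then 1 else 0)"
      using invb ij sqrt_gG[OF ij(1)] unfolding is_inv_def by auto
    finally show "(\<Sum>k\<in>?I. ?N i k * (?G k * mat_inv_on ?I ?b k j * ?G j)) = (if i = j then 1 else 0)" .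
  qed
  \<comment> \<open>\<open>AT\<close> is a choice, so a witness is needed before it may be treated
    as a genuine inverse; the rescaled inverse of \<open>bm\<close> provides one.\<close>
  then have "\<exists>C. is_inv ?I ?N C" by blast
  then have invN: "is_inv ?I ?N (mat_inv_on ?I ?N)"
    unfolding is_inv_def mat_inv_on_def by (rule someI_ex)
  have "is_inv ?I ?b (AtT K lam a (ym K w) t)"
    unfolding is_inv_def
  proof (intro ballI)
    fix i j assume ij: "i \<in> ?I" "j \<in> ?I"
    have "?b i k * AtT K lam a (ym K w) t k j = ?G i * (?N i k * mat_inv_on ?I ?N k j) * ?g j"
      if "k \<in> ?I" for k
    proof -
      have "?b i k * AtT K lam a (ym K w) t k j =
          (?g k * ?G k) * (?G i * (?N i k * mat_inv_on ?I ?N k j) * ?g j)"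
        unfolding b AtT_def AT_def by (simp only: mult_ac)
      then show ?thesis unfolding sqrt_gG[OF that] by (simp only: mult_1)
    qed
    then have "(\<Sum>k\<in>?I. ?b i k * AtT K lam a (ym K w) t k j) =
        ?G i * (\<Sum>k\<in>?I. ?N i k * mat_inv_on ?I ?N k j) * ?g j"
      unfolding sum_distrib_left sum_distrib_right by (intro sum.cong refl)
    also have "\<dots> = (if i = j then 1 else 0)"
      using invN ij sqrt_gG[OF ij(1)] unfolding is_inv_def by (auto simp: mult.commute)
    finally show "(\<Sum>k\<in>?I. ?b i k * AtT K lam a (ym K w) t k j) = (if i = j then 1 else 0)" .
  qed
  from mat_inv_on_eq[OF pd_bm L0 this assms] show ?thesis by simp
qed

lemma Qd_AtT: "Qd {1..K} w (AtT K lam a (yof {1..K} lam t x w) t) = Qd {1..K} w (mat_inv_on {1..K} (bm K w))"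
  unfolding yof_eq by (rule Qd_cong) (use AtT_eq in auto)

text \<open>Rescaling leaves the quadratic form unchanged and multiplies the root of the determinant
  by the reciprocal Jacobian of the map from \<open>w\<close> to \<open>y\<close>.\<close>

lemma Qd_AT:
  assumes "\<And>i. i \<in> {1..K} \<Longrightarrow> y i = xp lam t x i + sqrt (g i) * w i" "y \<in> PiE {1..K} (\<lambda>_. UNIV)"
  shows "Qd {1..K} (\<lambda>i. y i - xp lam t x i) (AT K lam a y t) =
    (\<Prod>i\<in>{1..K}. 1 / sqrt (g i)) * Qd {1..K} w (mat_inv_on {1..K} (bm K w))"
proof -
  let ?I = "{1..K}" and ?B = "mat_inv_on {1..K} (bm K w)"
  have y: "y = ym K w" using assms unfolding ym_def by (auto simp: fun_eq_iff restrict_def PiE_def extensional_def)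
  have A: "AT K lam a y t i j = 1 / sqrt (g i) * ?B i j * (1 / sqrt (g j))" if "i \<in> ?I" "j \<in> ?I" for i j
    using AtT_eq[OF that, of w] g_pos[OF that(1)] g_pos[OF that(2)] unfolding y[symmetric] AtT_def
    by (simp add: field_simps)
  have "Qd ?I (\<lambda>i. y i - xp lam t x i) (AT K lam a y t) =
      Qd ?I (\<lambda>i. sqrt (g i) * w i) (\<lambda>i j. 1 / sqrt (g i) * ?B i j * (1 / sqrt (g j)))"
    by (rule Qd_cong) (use A assms in auto)
  moreover have "quad_on ?I (\<lambda>i j. 1 / sqrt (g i) * ?B i j * (1 / sqrt (g j))) (\<lambda>i. sqrt (g i) * w i) = quad_on ?I ?B w"
    unfolding quad_on_def
  proof (intro sum.cong refl)
    fix i j assume "i \<in> ?I" "j \<in> ?I"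
    then show "sqrt (g i) * w i * (1 / sqrt (g i) * ?B i j * (1 / sqrt (g j))) * (sqrt (g j) * w j) = w i * ?B i j * w j"
      using g_pos[of i] g_pos[of j] by (simp add: field_simps)
  qed
  moreover have "det_on ?I (\<lambda>i j. 1 / sqrt (g i) * ?B i j * (1 / sqrt (g j))) =
      (\<Prod>i\<in>?I. 1 / sqrt (g i))\<^sup>2 * det_on ?I ?B"
    by (rule det_on_scale) simp
  moreover have "(\<Prod>i\<in>?I. 1 / sqrt (g i)) \<ge> 0" by (intro prod_nonneg) (use g_pos in \<open>auto simp: less_imp_le\<close>)
  ultimately show ?thesis unfolding Qd_def by (simp add: real_sqrt_mult)
qed

text \<open>The substitution \<open>y = x' + g^(1/2) w\<close> produces the Jacobian that cancels
  the factor in \<open>Qd_AT\<close>.\<close>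

lemma AT_integral:
  "(\<integral>\<^sup>+y. ennreal (Qd {1..K} (\<lambda>i. y i - xp lam t x i) (AT K lam a y t)) \<partial>leb {1..K}) =
   (\<integral>\<^sup>+w. ennreal (Qd {1..K} w (mat_inv_on {1..K} (bm K w))) \<partial>leb {1..K})"
proof -
  let ?I = "{1..K}"
  let ?f = "\<lambda>y. ennreal (Qd ?I (\<lambda>i. y i - xp lam t x i) (AT K lam a y t))"
  let ?W = "\<lambda>y i. (y i - xp lam t x i) / sqrt (g i)"
  let ?q = "\<lambda>w. Qd ?I w (mat_inv_on ?I (bm K w))"
  let ?P = "\<Prod>i\<in>?I. 1 / sqrt (g i)"
  have P: "?P \<ge> 0" by (intro prod_nonneg) (use g_pos in \<open>auto simp: less_imp_le\<close>)
  have Pg: "(\<Prod>i\<in>?I. sqrt (g i)) * ?P = 1"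
    unfolding prod.distrib[symmetric] by (rule prod.neutral) (use g_pos in force)
  have g0: "(\<Prod>i\<in>?I. sqrt (g i)) \<ge> 0" by (intro prod_nonneg) (use g_pos in \<open>auto simp: less_imp_le\<close>)
  \<comment> \<open>Expressing the integrand through the rescaled displacement \<open>?W\<close>
    reduces its measurability to \<open>measurable_Qd_bm\<close>.\<close>
  have f: "?f y = ennreal (?P * ?q (?W y))" if "y \<in> space (leb ?I)" for y
  proof -
    have "y i = xp lam t x i + sqrt (g i) * ?W y i" if "i \<in> ?I" for i using g_pos[OF that] by simp
    then show ?thesis using that by (subst Qd_AT[where w="?W y"]) (auto simp: space_PiM)
  qed
  have "(\<lambda>y. ?q (?W y)) \<in> borel_measurable (leb ?I)"
    by (rule measurable_Qd_bm) auto
  then have meas: "?f \<in> borel_measurable (leb ?I)"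
    by (subst measurable_cong[OF f]) auto
  have "(\<integral>\<^sup>+y. ?f y \<partial>leb ?I) = ennreal (\<Prod>i\<in>?I. sqrt (g i)) *
      (\<integral>\<^sup>+w. ?f (restrict (\<lambda>i. xp lam t x i + sqrt (g i) * w i) ?I) \<partial>leb ?I)"
    by (rule nn_integral_PiM_affine[OF _ _ meas]) (use g_pos in auto)
  also have "(\<lambda>w. ?f (restrict (\<lambda>i. xp lam t x i + sqrt (g i) * w i) ?I)) = (\<lambda>w. ennreal ?P * ennreal (?q w))"
  proof
    fix w
    show "?f (restrict (\<lambda>i. xp lam t x i + sqrt (g i) * w i) ?I) = ennreal ?P * ennreal (?q w)"
      by (subst Qd_AT[where w=w]) (use P in \<open>auto simp: ennreal_mult'\<close>)
  qed
  also have "(\<integral>\<^sup>+w. ennreal ?P * ennreal (?q w) \<partial>leb ?I) = ennreal ?P * (\<integral>\<^sup>+w. ennreal (?q w) \<partial>leb ?I)"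
    by (rule nn_integral_cmult) (intro measurable_compose[OF _ measurable_ennreal] measurable_Qd_bm, auto)
  also have "ennreal (\<Prod>i\<in>?I. sqrt (g i)) * \<dots> = (\<integral>\<^sup>+w. ennreal (?q w) \<partial>leb ?I)"
    unfolding mult.assoc[symmetric] using P g0 Pg by (simp add: ennreal_mult[symmetric])
  finally show ?thesis .
qed

end

section \<open>Choice of the uniform constant and conclusion of (a) and (b)\<close>

theorem theorem5p3:
  fixes L0 L1 kl \<alpha> \<beta> kb p :: real
  assumes "0 < L0" "L0 \<le> L1" "0 < kl"
    and "1/2 < \<alpha>" "\<alpha> \<le> 1" "\<beta> > 3 - \<alpha>" "p \<ge> 0"
  shows "\<exists>c1::real. \<forall>K::nat. \<forall>lam a. 1 \<le> K \<longrightarrow> setting L0 L1 kl \<alpha> \<beta> kb K lam a \<longrightarrow>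
     (\<forall>t::real. \<forall>x\<in>PiE {1..K} (\<lambda>_. UNIV::real set). t > 0 \<longrightarrow>
        (\<forall>j\<in>{1..K}.
           (\<integral>\<^sup>+ w. ennreal (abspow (w j) (2 * p) *
                Qd {1..K} w (AtT K lam a (yof {1..K} lam t x w) t)) \<partial>(PiM {1..K} (\<lambda>_. lborel)))
           \<le> ennreal c1 *
             ((\<integral>\<^sup>+ w. ennreal (abspow (w j) (2 * p) *
                Qd {1..j} w (Atm K lam a x j (yof {1..j} lam t x w) t)) \<partial>(PiM {1..j} (\<lambda>_. lborel))) + 1))
        \<and> (\<integral>\<^sup>+ w. ennreal (Qd {1..K} w (AtT K lam a (yof {1..K} lam t x w) t))
              \<partial>(PiM {1..K} (\<lambda>_. lborel))) \<le> ennreal c1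
        \<and> (\<integral>\<^sup>+ y. ennreal (Qd {1..K} (\<lambda>i. y i - xp lam t x i) (AT K lam a y t))
              \<partial>(PiM {1..K} (\<lambda>_. lborel))) \<le> ennreal c1)"
proof -
  have L1: "L1 > 0" using assms by linarith
  \<comment> \<open>The rate is \<open>\<alpha> + \<beta> - 3\<close> for the Hoelder error, capped
    at \<open>1\<close> for the tail estimate in \<open>moment_bound\<close>.\<close>
  define e where "e = min 1 (\<alpha> + \<beta> - 3)"
  have e: "0 < e" "e \<le> 1" "e \<le> \<alpha> + \<beta> - 3" unfolding e_def using assms by auto
  define c where "c q = 1 + (q / (1 / (8 * L1))) powr q" for q
  have c: "abspow z (2 * q) \<le> c q * exp (1 / (8 * L1) * z\<^sup>2)" if "q \<ge> 0" for q z
    unfolding c_def by (rule abspow_le_exp) (use that L1 in auto)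
  \<comment> \<open>One number majorises both the multiplicative and the additive error of a
    step.\<close>
  define T where "T q = max (step_const L0 kl \<alpha> kb (trunc_radius L0 L1)) (c q)" for q
  have T: "step_const L0 kl \<alpha> kb (trunc_radius L0 L1) \<le> T q" "c q \<le> T q" for q
    unfolding T_def by auto
  have T0: "0 \<le> T q" for q by (rule order_trans[OF _ T(2)]) (simp add: c_def)
  define M where "M q = exp (T q / (1 - 2 powr - e)) * (1 + T q / (1 - 2 powr - e))" for q
  have M0: "M q \<ge> 0" for q
  proof -
    have "2 powr - e < 1" using e by (simp add: powr_less_one)
    then show ?thesis unfolding M_def using T0[of q] by simp
  qed
  define r where "r = (L1 / L0) powr (1 / 2) + 1"
  have r0: "r \<ge> 0" unfolding r_def by simp
  show ?thesis
  proof (intro exI allI impI ballI conjI)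
    fix K :: nat and lam a t x
    assume K: "1 \<le> K" and s: "setting L0 L1 kl \<alpha> \<beta> kb K lam a" and t: "(t::real) > 0"
    interpret ou_setting L0 L1 kl \<alpha> \<beta> kb K lam a t x
      by unfold_locales (use assms s t in auto)
    \<comment> \<open>The witness for \<open>c1\<close> is \<open>M p + M 0 * r\<close>: the first
      summand serves (a), the second (b).\<close>
    have le: "ennreal (M p) \<le> ennreal (M p + M 0 * r)" using M0[of 0] r0 by (intro ennreal_leI) simp
    { fix j assume j: "j \<in> {1..K}"
      have "moment p j K \<le> ennreal (M p) * (moment p j j + 1)"
        unfolding M_def
        by (rule moment_bound[OF _ _ assms(7) c[OF assms(7)] e T(1,2) T0]) (use j in auto)
      also have "\<dots> \<le> ennreal (M p + M 0 * r) * (moment p j j + 1)" using le by (rule mult_right_mono) simp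
      finally show "(\<integral>\<^sup>+ w. ennreal (abspow (w j) (2 * p) *
                Qd {1..K} w (AtT K lam a (yof {1..K} lam t x w) t)) \<partial>(PiM {1..K} (\<lambda>_. lborel)))
           \<le> ennreal (M p + M 0 * r) *
             ((\<integral>\<^sup>+ w. ennreal (abspow (w j) (2 * p) *
                Qd {1..j} w (Atm K lam a x j (yof {1..j} lam t x w) t)) \<partial>(PiM {1..j} (\<lambda>_. lborel))) + 1)"
        unfolding moment_def Qd_AtT using j by (simp add: Atm_eq) }
    \<comment> \<open>Part (b) is the chain with \<open>p = 0\<close> and \<open>j = 1\<close>, as
      \<open>abspow z 0 = 1\<close>; \<open>r\<close> bounds its starting value
      \<open>moment 0 1 1 + 1\<close>.\<close>
    have "moment 0 1 K \<le> ennreal (M 0) * (moment 0 1 1 + 1)"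
      unfolding M_def by (rule moment_bound[OF _ K _ c e T(1,2) T0]) auto
    also have "\<dots> \<le> ennreal (M 0) * ennreal r"
      unfolding r_def using moment_one[OF K] by (intro mult_left_mono) (auto simp: add_right_mono)
    also have "\<dots> = ennreal (M 0 * r)" using M0 r0 by (simp add: ennreal_mult)
    also have "\<dots> \<le> ennreal (M p + M 0 * r)" using M0[of p] by (intro ennreal_leI) simp
    finally have m: "moment 0 1 K \<le> ennreal (M p + M 0 * r)" .
    have m0: "moment 0 1 K = (\<integral>\<^sup>+w. ennreal (Qd {1..K} w (mat_inv_on {1..K} (bm K w))) \<partial>leb {1..K})"
      unfolding moment_def by (simp add: abspow_def)
    show "(\<integral>\<^sup>+ w. ennreal (Qd {1..K} w (AtT K lam a (yof {1..K} lam t x w) t))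
              \<partial>(PiM {1..K} (\<lambda>_. lborel))) \<le> ennreal (M p + M 0 * r)"
      unfolding Qd_AtT using m unfolding m0 .
    show "(\<integral>\<^sup>+ y. ennreal (Qd {1..K} (\<lambda>i. y i - xp lam t x i) (AT K lam a y t))
              \<partial>(PiM {1..K} (\<lambda>_. lborel))) \<le> ennreal (M p + M 0 * r)"
      unfolding AT_integral using m unfolding m0 .
  qed
qed

end
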